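(* There exists a family of bipartite graphs $G_n=(V_1\cup V_2,E)$, with number of vertices polynomial in $n$, such that the extension complexity of the maximal matching polytope $MM(G_n)$ is not bounded by any polynomial in $n$.
   Context: A matching in $G=(V,E)$ is maximal if it is not properly contained in another matching of $G$. The maximal matching polytope $MM(G)$ is the convex hull of the 0/1 incidence vectors in $\mathbb{R}^E$ of all maximal matchings of $G$. The extension complexity $\mathrm{xc}(Q)$ of a polytope $Q$ is the minimum number of facets of a polytope $Q'$ such that $Q$ is a linear image of $Q'$. *)

theory Defs
  imports "HOL-Analysis.Analysis" "HOL-Library.Function_Algebras"
begin

text \<open>We model R^E (E a finite edge set) as functions from edges to reals that vanish
  off E, and the ambient spaces R^m of extensions as (nat => real); for this we equip
  function spaces with their pointwise real vector space structure.\<close>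

instantiation "fun" :: (type, real_vector) real_vector
begin
definition scaleR_fun :: "real \<Rightarrow> ('a \<Rightarrow> 'b) \<Rightarrow> 'a \<Rightarrow> 'b"
  where "scaleR_fun r f = (\<lambda>x. r *\<^sub>R f x)"
instance
  by standard (auto simp: scaleR_fun_def fun_eq_iff scaleR_add_right scaleR_add_left)
end

definition affdim :: "'a::real_vector set \<Rightarrow> int" where
  "affdim S = (if S = {} then -1 else int (dim {x - y | x y. x \<in> S \<and> y \<in> S}))"

definition is_facet :: "'a::real_vector set \<Rightarrow> 'a set \<Rightarrow> bool" where
  "is_facet F P \<longleftrightarrow> F face_of P \<and> F \<noteq> {} \<and> affdim F = affdim P - 1"

text \<open>Extension complexity: the minimum number of facets of a polytope Q' (in some R^m,
  here embedded in nat => real) such that Q is a linear image of Q'.\<close>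
definition ext_complexity :: "('b::real_vector) set \<Rightarrow> nat" where
  "ext_complexity Q =
     (LEAST k. \<exists>(P :: (nat \<Rightarrow> real) set) (f :: (nat \<Rightarrow> real) \<Rightarrow> 'b).
        polytope P \<and> linear f \<and> f ` P = Q \<and> card {F. is_facet F P} = k)"

definition graph :: "'a set \<Rightarrow> 'a set set \<Rightarrow> bool" where
  "graph V E \<longleftrightarrow> finite V \<and> (\<forall>e\<in>E. \<exists>u v. u \<in> V \<and> v \<in> V \<and> u \<noteq> v \<and> e = {u, v})"

definition bipartite :: "'a set \<Rightarrow> 'a set set \<Rightarrow> bool" where
  "bipartite V E \<longleftrightarrow> graph V E \<and>
     (\<exists>V1 V2. V1 \<inter> V2 = {} \<and> V1 \<union> V2 = V \<and>
        (\<forall>e\<in>E. \<exists>u v. u \<in> V1 \<and> v \<in> V2 \<and> e = {u, v}))"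

definition matching :: "'a set set \<Rightarrow> 'a set set \<Rightarrow> bool" where
  "matching E M \<longleftrightarrow> M \<subseteq> E \<and> (\<forall>e\<in>M. \<forall>e'\<in>M. e \<noteq> e' \<longrightarrow> e \<inter> e' = {})"

definition maximal_matching :: "'a set set \<Rightarrow> 'a set set \<Rightarrow> bool" where
  "maximal_matching E M \<longleftrightarrow> matching E M \<and> \<not> (\<exists>M'. matching E M' \<and> M \<subset> M')"

definition incidence_vector :: "'a set set \<Rightarrow> 'a set \<Rightarrow> real" where
  "incidence_vector M = indicator M"

definition maximal_matching_polytope :: "'a set set \<Rightarrow> ('a set \<Rightarrow> real) set" where
  "maximal_matching_polytope E =
     convex hull {incidence_vector M | M. maximal_matching E M}"

end

theory Submission
  imports Defs "HOL-Library.Nat_Bijection"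
begin

text \<open>If a polytope \<open>Q\<close> is the image of a polytope \<open>P\<close>, then every facet \<open>F\<close> of \<open>P\<close> gives a rectangle
  of pairs (face of \<open>Q\<close>, point of \<open>Q\<close>): the lifted face lies in \<open>F\<close>, the lifted point does not. As
  every nonempty face of \<open>P\<close> is the intersection of \<open>P\<close> and the facets above it, these rectangles
  cover all non-incident pairs. If the faces and points are indexed by the subsets \<open>a\<close>, \<open>b\<close> of an
  \<open>n\<close>-set so that incidence holds when \<open>\<bar>a \<inter> b\<bar> = 1\<close> and fails when \<open>a \<inter> b = {}\<close>, then by
  Kaibel and Weltge each rectangle contains at most \<open>2 ^ n\<close> of the \<open>3 ^ n\<close> disjoint pairs, so about
  \<open>(3 / 2) ^ n\<close> facets are needed.

  Such faces and points exist for the stable sets of the twice subdivided complete graph: each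
  subdivided edge contains at most one subdivision vertex of a stable set, and none if both ends
  are chosen, which yields a valid inequality with slack \<open>(1 - \<bar>a \<inter> b\<bar>)\<^sup>2\<close>. The stable
  sets of an arbitrary graph in turn correspond to the vertices of a face of the maximal matching
  polytope of a bipartite graph with four times as many vertices.\<close>

section \<open>Faces and facets of polytopes\<close>

text \<open>For \<open>m \<in> P\<close> this is the smallest face through \<open>m\<close>.
  Convexity holds because weights proportional to \<open>s * e\<close> and \<open>t * d\<close> give
  the two overshoots beyond \<open>m\<close> a common length.\<close>

lemma convex_minimal_face:
  assumes "convex P"
  shows "{x \<in> P. \<exists>e>0. m + e *\<^sub>R (m - x) \<in> P} face_of P" (is "?T face_of P")
proof -
  have "convex ?T"
  proof (rule convexI)
    fix x y and s t :: real
    assume x: "x \<in> ?T" and y: "y \<in> ?T" and st: "0 \<le> s" "0 \<le> t" "s + t = 1"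
    from x obtain d where d: "d > 0" "m + d *\<^sub>R (m - x) \<in> P" by auto
    from y obtain e where e: "e > 0" "m + e *\<^sub>R (m - y) \<in> P" by auto
    define D where "D = s * e + t * d"
    have D: "D > 0"
    proof (cases "s = 0")
      case True then show ?thesis using st d by (simp add: D_def)
    next
      case False then show ?thesis using st d e by (simp add: D_def add_pos_nonneg)
    qed
    have one: "s * e / D + t * d / D = 1"
      using D by (simp add: D_def flip: add_divide_distrib)
    have "(s * e / D) *\<^sub>R (m + d *\<^sub>R (m - x)) + (t * d / D) *\<^sub>R (m + e *\<^sub>R (m - y)) \<in> P"
      using D st d e by (intro convexD[OF assms _ _ _ _ one]) auto
    also have "(s * e / D) *\<^sub>R (m + d *\<^sub>R (m - x)) + (t * d / D) *\<^sub>R (m + e *\<^sub>R (m - y))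
        = ((s * e + t * d) / D) *\<^sub>R m + (d * e / D) *\<^sub>R (s *\<^sub>R (m - x) + t *\<^sub>R (m - y))"
      by (simp add: algebra_simps add_divide_distrib)
    also have "s *\<^sub>R (m - x) + t *\<^sub>R (m - y) = (s + t) *\<^sub>R m - (s *\<^sub>R x + t *\<^sub>R y)"
      by (simp add: algebra_simps)
    finally have "m + (d * e / D) *\<^sub>R (m - (s *\<^sub>R x + t *\<^sub>R y)) \<in> P"
      using D st by (simp add: D_def)
    moreover have "d * e / D > 0" using d e D by simp
    moreover have "s *\<^sub>R x + t *\<^sub>R y \<in> P"
      using x y st by (intro convexD[OF assms]) auto
    ultimately show "s *\<^sub>R x + t *\<^sub>R y \<in> ?T" by blast
  qed
  moreover have "a \<in> ?T" if ab: "a \<in> P" "b \<in> P" and x: "x \<in> ?T" "x \<in> open_segment a b" for a b x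
  proof -
    obtain u where u: "0 < u" "u < 1" "x = (1 - u) *\<^sub>R a + u *\<^sub>R b"
      using x by (auto simp: in_segment)
    obtain e where e: "e > 0" "m + e *\<^sub>R (m - x) \<in> P" using x by auto
    \<comment> \<open>Mixing the overshoot of \<open>x\<close> with \<open>b\<close> in the ratio
      \<open>1 : e * u\<close> cancels \<open>b\<close> and leaves an overshoot of
      \<open>a\<close>.\<close>
    define D where "D = 1 + e * u"
    have D: "D > 0" using e u by (simp add: D_def add_pos_pos)
    have "(1 / D) *\<^sub>R (m + e *\<^sub>R (m - x)) + (e * u / D) *\<^sub>R b \<in> P"
    proof (rule convexD[OF assms e(2) ab(2)])
      show "1 / D + e * u / D = 1" using D by (simp add: D_def flip: add_divide_distrib)
    qed (use D e u in auto)
    also have "(1 / D) *\<^sub>R (m + e *\<^sub>R (m - x)) + (e * u / D) *\<^sub>R b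
       = ((1 + e) / D) *\<^sub>R m - (e * (1 - u) / D) *\<^sub>R a"
      unfolding u(3) by (simp add: algebra_simps add_divide_distrib diff_divide_distrib)
    also have "(1 + e) / D = 1 + e * (1 - u) / D"
      using D by (simp add: D_def field_simps)
    finally have "m + (e * (1 - u) / D) *\<^sub>R (m - a) \<in> P"
      by (simp add: algebra_simps)
    moreover have "e * (1 - u) / D > 0" using e u D by simp
    ultimately show ?thesis using ab by blast
  qed
  ultimately show ?thesis
    unfolding face_of_def using open_segment_commute by blast
qed

text \<open>If \<open>v\<close> has positive weight in a combination \<open>x \<in> F\<close>, then
  \<open>x = v\<close> or \<open>x\<close> lies strictly between \<open>v\<close> and the normalised
  rest \<open>y\<close>; in both cases \<open>F\<close> contains \<open>v\<close>.\<close>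

lemma face_of_convex_hull_finite:
  assumes V: "finite V" and F: "F face_of convex hull V"
  shows "F = convex hull (V \<inter> F)"
proof
  have cF: "convex F" and FP: "F \<subseteq> convex hull V" using F by (auto simp: face_of_def)
  show "convex hull (V \<inter> F) \<subseteq> F"
    by (rule hull_minimal) (use cF in auto)
  show "F \<subseteq> convex hull (V \<inter> F)"
  proof
    fix x assume x: "x \<in> F"
    then obtain u where u: "\<And>v. v \<in> V \<Longrightarrow> 0 \<le> u v" "sum u V = 1" "(\<Sum>v\<in>V. u v *\<^sub>R v) = x"
      using FP convex_hull_finite[OF V] by auto
    have pos: "v \<in> F" if v: "v \<in> V" "u v \<noteq> 0" for v
    proof (cases "u v = 1")
      case True
      have "sum u (V - {v}) = 0" using V v u True by (simp add: sum_diff1)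
      then have "\<forall>w\<in>V - {v}. u w = 0" using V u by (subst (asm) sum_nonneg_eq_0_iff) auto
      then have "(\<Sum>w\<in>V. u w *\<^sub>R w) = v"
        using V v True by (subst sum.remove[of _ v]) auto
      then show ?thesis using u x by simp
    next
      case False
      define r where "r = 1 - u v"
      have s: "sum u (V - {v}) = r" using V v u by (simp add: sum_diff1 r_def)
      have "r \<ge> 0" unfolding s[symmetric] using u by (intro sum_nonneg) auto
      then have r: "0 < r" "r < 1" using False v u(1)[of v] by (auto simp: r_def)
      define y where "y = (\<Sum>w\<in>V-{v}. (u w / r) *\<^sub>R w)"
      have "y \<in> convex hull V" unfolding y_def
        using V u r s by (intro convex_sum) (auto simp: hull_inc simp flip: sum_divide_distrib)
      moreover have xe: "x = (1 - r) *\<^sub>R v + r *\<^sub>R y"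
        unfolding u(3)[symmetric] y_def using V v r
        by (subst sum.remove[of _ v]) (auto simp: scaleR_sum_right r_def)
      moreover have "v \<in> convex hull V" using v by (simp add: hull_inc)
      ultimately show ?thesis
      proof (cases "v = y")
        case True
        then have "x = v" using xe by (simp flip: scaleR_left_distrib)
        then show ?thesis using x by simp
      next
        case False
        then have "x \<in> open_segment v y" using xe r by (auto simp: in_segment)
        then show ?thesis using F x \<open>y \<in> _\<close> \<open>v \<in> convex hull V\<close> by (auto dest: face_ofD)
      qed
    qed
    have "x = (\<Sum>v\<in>V \<inter> F. u v *\<^sub>R v)"
      unfolding u(3)[symmetric] using V pos by (intro sum.mono_neutral_right) auto
    moreover have "sum u V = sum u (V \<inter> F)"
      using V pos by (intro sum.mono_neutral_right) auto
    ultimately show "x \<in> convex hull (V \<inter> F)"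
      using V u by (auto simp: convex_hull_finite)
  qed
qed

lemma finite_faces_convex_hull:
  assumes "finite V"
  shows "finite {F. F face_of convex hull V}"
proof (rule finite_subset)
  show "{F. F face_of convex hull V} \<subseteq> (\<lambda>S. convex hull S) ` Pow V"
    using face_of_convex_hull_finite[OF assms] by blast
qed (use assms in simp)

section \<open>Feasible directions at a point of a convex set\<close>

definition feasible_directions :: "'a::real_vector set \<Rightarrow> 'a \<Rightarrow> 'a set" where
  "feasible_directions P z = {d. \<exists>e>0. z + e *\<^sub>R d \<in> P}"

lemma feasible_directions_add:
  assumes P: "convex P" and "x \<in> feasible_directions P z" "y \<in> feasible_directions P z"
  shows "x + y \<in> feasible_directions P z"
proof -
  obtain d e where d: "d > 0" "z + d *\<^sub>R x \<in> P" and e: "e > 0" "z + e *\<^sub>R y \<in> P"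
    using assms by (auto simp: feasible_directions_def)
  have one: "e / (d + e) + d / (d + e) = 1"
    using d e by (simp add: add.commute flip: add_divide_distrib)
  have "(e / (d + e)) *\<^sub>R (z + d *\<^sub>R x) + (d / (d + e)) *\<^sub>R (z + e *\<^sub>R y) \<in> P"
    using d e by (intro convexD[OF P _ _ _ _ one]) auto
  also have "(e / (d + e)) *\<^sub>R (z + d *\<^sub>R x) + (d / (d + e)) *\<^sub>R (z + e *\<^sub>R y)
     = ((d + e) / (d + e)) *\<^sub>R z + (d * e / (d + e)) *\<^sub>R (x + y)"
    by (simp only: add_divide_distrib) (simp add: algebra_simps)
  finally have "z + (d * e / (d + e)) *\<^sub>R (x + y) \<in> P" using d e by simp
  moreover have "d * e / (d + e) > 0" using d e by simp
  ultimately show ?thesis unfolding feasible_directions_def by blast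
qed

lemma feasible_directions_scale:
  assumes "z \<in> P" "x \<in> feasible_directions P z" "c \<ge> 0"
  shows "c *\<^sub>R x \<in> feasible_directions P z"
proof (cases "c = 0")
  case True
  then show ?thesis using assms by (auto simp: feasible_directions_def intro: exI[of _ 1])
next
  case False
  obtain d where "d > 0" "z + d *\<^sub>R x \<in> P"
    using assms by (auto simp: feasible_directions_def)
  then show ?thesis using False assms
    by (auto simp: feasible_directions_def intro!: exI[of _ "d / c"])
qed

lemma feasible_directions_sum:
  assumes "convex P" "z \<in> P" "finite W" "\<And>w. w \<in> W \<Longrightarrow> f w \<in> feasible_directions P z"
  shows "sum f W \<in> feasible_directions P z"
  using assms(3,4)
proof (induction W)
  case empty
  then show ?case using assms(2) by (auto simp: feasible_directions_def intro: exI[of _ 1])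
next
  case (insert w W)
  then show ?case by (simp add: feasible_directions_add[OF assms(1)])
qed

text \<open>At the barycentre all weights are positive, so every \<open>s - z\<close> is feasible
  together with its negative, and directions with this property form a subspace.\<close>

lemma span_feasible_at_mean:
  fixes S :: "'a::real_vector set"
  assumes S: "finite S" "S \<noteq> {}"
  defines "z \<equiv> (1 / real (card S)) *\<^sub>R \<Sum>S"
  assumes d: "d \<in> span ((\<lambda>s. s - z) ` S)"
  shows "d \<in> feasible_directions (convex hull S) z"
proof -
  let ?R = "feasible_directions (convex hull S) z"
  define N where "N = real (card S)"
  have N: "N > 0" using S by (simp add: N_def card_gt_0_iff)
  have conv: "convex (convex hull S)" by simp
  have mean: "\<And>u. (\<And>s. s \<in> S \<Longrightarrow> 0 \<le> u s) \<Longrightarrow> sum u S = 1 \<Longrightarrow> (\<Sum>s\<in>S. u s *\<^sub>R s) \<in> convex hull S"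
    using S by (auto simp: convex_hull_finite)
  have z: "z \<in> convex hull S"
    using mean[of "\<lambda>_. 1 / N"] N S by (simp add: z_def N_def scaleR_sum_right)
  have gen: "s - z \<in> ?R \<and> - (s - z) \<in> ?R" if s: "s \<in> S" for s
  proof
    have "z + 1 *\<^sub>R (s - z) \<in> convex hull S" using s by (simp add: hull_inc)
    then show "s - z \<in> ?R" unfolding feasible_directions_def using zero_less_one by blast
    \<comment> \<open>These weights move from \<open>z\<close> by \<open>1 / N\<close> times
      \<open>z - s\<close>: the weight of \<open>s\<close> drops to \<open>1 / N^2\<close> and so
      stays nonnegative.\<close>
    define u where "u t = (1 + 1 / N) / N - (if t = s then 1 / N else 0)" for t
    have "(\<Sum>t\<in>S. u t *\<^sub>R t) \<in> convex hull S"
    proof (rule mean)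
      show "sum u S = 1" using S s N by (simp add: u_def sum_subtractf flip: N_def)
    qed (use N in \<open>auto simp: u_def field_simps\<close>)
    also have "(\<Sum>t\<in>S. u t *\<^sub>R t) = (1 + 1 / N) *\<^sub>R z - (1 / N) *\<^sub>R s"
      using S s by (simp add: u_def scaleR_left_diff_distrib sum_subtractf z_def scaleR_sum_right
          if_distrib[of "\<lambda>c. c *\<^sub>R _"] flip: N_def cong: if_cong)
    also have "\<dots> = z + (1 / N) *\<^sub>R (- (s - z))" by (simp add: algebra_simps)
    finally show "- (s - z) \<in> ?R" unfolding feasible_directions_def using N
      by (intro CollectI exI[of _ "1 / N"] conjI) auto
  qed
  have "subspace {d. d \<in> ?R \<and> - d \<in> ?R}"
  proof (rule subspaceI)
    show "0 \<in> {d. d \<in> ?R \<and> - d \<in> ?R}"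
      using z by (auto simp: feasible_directions_def intro: exI[of _ 1])
  next
    fix x y assume "x \<in> {d. d \<in> ?R \<and> - d \<in> ?R}" "y \<in> {d. d \<in> ?R \<and> - d \<in> ?R}"
    then show "x + y \<in> {d. d \<in> ?R \<and> - d \<in> ?R}"
      using feasible_directions_add[OF conv, of x z y] feasible_directions_add[OF conv, of "-x" z "-y"]
      by simp
  next
    fix c x assume x: "x \<in> {d. d \<in> ?R \<and> - d \<in> ?R}"
    show "c *\<^sub>R x \<in> {d. d \<in> ?R \<and> - d \<in> ?R}"
      using x feasible_directions_scale[OF z, of x c] feasible_directions_scale[OF z, of "-x" c]
        feasible_directions_scale[OF z, of x "-c"] feasible_directions_scale[OF z, of "-x" "-c"]
      by (cases "c \<ge> 0") auto
  qed
  then have "span ((\<lambda>s. s - z) ` S) \<subseteq> {d. d \<in> ?R \<and> - d \<in> ?R}"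
    using gen by (intro span_minimal) auto
  then show ?thesis using d by auto
qed

section \<open>Finitely generated cones modulo a subspace\<close>

text \<open>In the application \<open>L\<close> is the direction space of a face and
  \<open>W\<close> holds the directions from its barycentre to the vertices outside it.\<close>

definition cone_plus :: "'a::real_vector set \<Rightarrow> 'a set \<Rightarrow> 'a set" where
  "cone_plus L W = {x. \<exists>u l. (\<forall>w\<in>W. 0 \<le> u w) \<and> l \<in> L \<and> x = (\<Sum>w\<in>W. u w *\<^sub>R w) + l}"

lemma cone_plusI:
  assumes "\<And>w. w \<in> W \<Longrightarrow> 0 \<le> u w" "l \<in> L" "x = (\<Sum>w\<in>W. u w *\<^sub>R w) + l"
  shows "x \<in> cone_plus L W"
  unfolding cone_plus_def using assms by blast

lemma cone_plus_add:
  assumes "subspace L" "x \<in> cone_plus L W" "y \<in> cone_plus L W"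
  shows "x + y \<in> cone_plus L W"
proof -
  obtain u l where u: "\<forall>w\<in>W. (0::real) \<le> u w" "l \<in> L" "x = (\<Sum>w\<in>W. u w *\<^sub>R w) + l"
    using assms(2) by (auto simp: cone_plus_def)
  obtain v k where v: "\<forall>w\<in>W. (0::real) \<le> v w" "k \<in> L" "y = (\<Sum>w\<in>W. v w *\<^sub>R w) + k"
    using assms(3) by (auto simp: cone_plus_def)
  show ?thesis
  proof (rule cone_plusI)
    show "0 \<le> u w + v w" if "w \<in> W" for w using that u(1) v(1) by simp
    show "l + k \<in> L" using assms(1) u(2) v(2) by (rule subspace_add)
    have a: "(\<Sum>w\<in>W. (u w + v w) *\<^sub>R w) = (\<Sum>w\<in>W. u w *\<^sub>R w + v w *\<^sub>R w)"
      by (simp only: scaleR_left_distrib)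
    have b: "\<dots> = (\<Sum>w\<in>W. u w *\<^sub>R w) + (\<Sum>w\<in>W. v w *\<^sub>R w)"
      by (rule sum.distrib)
    have swap: "(p + l) + (q + k) = (p + q) + (l + k)" for p q :: 'a
      by (simp add: algebra_simps)
    show "x + y = (\<Sum>w\<in>W. (u w + v w) *\<^sub>R w) + (l + k)"
      unfolding a b u(3) v(3) by (rule swap)
  qed
qed

lemma cone_plus_scale:
  assumes "subspace L" "x \<in> cone_plus L W" "c \<ge> 0"
  shows "c *\<^sub>R x \<in> cone_plus L W"
proof -
  obtain u l where "\<forall>w\<in>W. (0::real) \<le> u w" "l \<in> L" "x = (\<Sum>w\<in>W. u w *\<^sub>R w) + l"
    using assms by (auto simp: cone_plus_def)
  then show ?thesis using assms unfolding cone_plus_def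
    by (auto intro!: exI[of _ "\<lambda>w. c * u w"] exI[of _ "c *\<^sub>R l"]
        simp: scaleR_right_distrib scaleR_sum_right subspace_scale)
qed

lemma cone_plus_superset: "L \<subseteq> cone_plus L W"
proof
  fix l assume "l \<in> L"
  then show "l \<in> cone_plus L W"
    unfolding cone_plus_def by (intro CollectI exI[of _ "\<lambda>_. 0"] exI[of _ l]) simp
qed

lemma cone_plus_generator:
  assumes "subspace L" "finite W" "w \<in> W"
  shows "w \<in> cone_plus L W"
proof -
  have "(\<Sum>v\<in>W. (if v = w then 1 else 0) *\<^sub>R v) = (\<Sum>v\<in>W. if v = w then w else 0)"
    by (rule sum.cong) auto
  also have "\<dots> = w" using assms by simp
  finally show ?thesis using assms unfolding cone_plus_def
    by (intro CollectI exI[of _ "\<lambda>v. if v = w then 1 else 0"] exI[of _ 0]) (simp add: subspace_0)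
qed

lemma cone_plus_insert:
  assumes "finite W" "w \<notin> W"
  shows "x \<in> cone_plus L (insert w W) \<longleftrightarrow> (\<exists>c\<ge>0. \<exists>y\<in>cone_plus L W. x = c *\<^sub>R w + y)"
proof
  assume "x \<in> cone_plus L (insert w W)"
  then obtain u l where "\<forall>v\<in>insert w W. (0::real) \<le> u v" "l \<in> L"
      "x = u w *\<^sub>R w + ((\<Sum>w\<in>W. u w *\<^sub>R w) + l)"
    using assms by (auto simp: cone_plus_def add.assoc)
  then show "\<exists>c\<ge>0. \<exists>y\<in>cone_plus L W. x = c *\<^sub>R w + y"
    by (intro exI[of _ "u w"] conjI bexI[of _ "(\<Sum>w\<in>W. u w *\<^sub>R w) + l"]) (auto simp: cone_plus_def)
next
  assume "\<exists>c\<ge>0. \<exists>y\<in>cone_plus L W. x = c *\<^sub>R w + y"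
  then obtain c u l where "c \<ge> 0" "\<forall>v\<in>W. (0::real) \<le> u v" "l \<in> L"
      "x = c *\<^sub>R w + ((\<Sum>w\<in>W. u w *\<^sub>R w) + l)"
    by (auto simp: cone_plus_def)
  moreover have "(\<Sum>v\<in>W. (if v = w then c else u v) *\<^sub>R v) = (\<Sum>v\<in>W. u v *\<^sub>R v)"
    using assms by (intro sum.cong) auto
  ultimately show "x \<in> cone_plus L (insert w W)"
    using assms unfolding cone_plus_def
    by (auto intro!: exI[of _ "\<lambda>v. if v = w then c else u v"] exI[of _ l] simp: add.assoc)
qed

text \<open>Gaussian elimination: a relation \<open>w = e p + c w + \<dots>\<close> can be solved for \<open>w\<close>, because
  \<open>c \<ge> 1\<close> would put \<open>-p\<close> into the cone.\<close>
lemma cone_plus_spanned_by_dominated: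
  assumes L: "subspace L" and "finite W"
    and "- p \<notin> cone_plus L W"
    and "\<And>w. w \<in> W \<Longrightarrow> \<exists>e>0. w - e *\<^sub>R p \<in> cone_plus L W"
  shows "W \<subseteq> span (insert p L)"
  using assms(2-)
proof (induction W)
  case (insert w W)
  note ins = cone_plus_insert[OF insert.hyps]
  have sub: "x \<in> cone_plus L (insert w W)" if "x \<in> cone_plus L W" for x
    unfolding ins using that by (intro exI[of _ 0] conjI bexI[of _ x]) auto
  have np: "- p \<notin> cone_plus L W" using insert.prems(1) sub by blast
  obtain e c y where e: "e > 0" "c \<ge> 0" "y \<in> cone_plus L W" "w - e *\<^sub>R p = c *\<^sub>R w + y"
    using insert.prems(2)[of w] ins by auto
  have c: "c < 1"
  proof (rule ccontr)
    assume "\<not> c < 1"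
    then have "(1 / e) *\<^sub>R ((c - 1) *\<^sub>R w + y) \<in> cone_plus L (insert w W)"
      using e(1,3) by (intro cone_plus_scale[OF L]) (auto simp: ins intro!: exI[of _ "c - 1"])
    moreover have "(c - 1) *\<^sub>R w + y = e *\<^sub>R (- p)"
      using e(4) by (simp add: algebra_simps)
    ultimately show False using e(1) insert.prems(1) by simp
  qed
  define f where "f = e / (1 - c)"
  define z where "z = (1 / (1 - c)) *\<^sub>R y"
  have f: "f > 0" using e c by (simp add: f_def)
  have z: "z \<in> cone_plus L W" unfolding z_def using e c by (intro cone_plus_scale[OF L]) auto
  have "(1 - c) *\<^sub>R w = e *\<^sub>R p + y" using e(4) by (simp add: algebra_simps)
  then have "(1 / (1 - c)) *\<^sub>R ((1 - c) *\<^sub>R w) = f *\<^sub>R p + z"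
    by (simp add: f_def z_def scaleR_right_distrib)
  then have w: "w = f *\<^sub>R p + z" using c by simp
  have W: "W \<subseteq> span (insert p L)"
  proof (rule insert.IH[OF np])
    fix v assume "v \<in> W"
    then obtain d k x where d: "d > 0" "k \<ge> 0" "x \<in> cone_plus L W" "v - d *\<^sub>R p = k *\<^sub>R w + x"
      using insert.prems(2)[of v] ins by auto
    \<comment> \<open>Substituting the solved form of \<open>w\<close> eliminates it from the
      relation for \<open>v\<close>, and the coefficient of \<open>p\<close> stays positive.\<close>
    have "v - (d + k * f) *\<^sub>R p = k *\<^sub>R z + x"
      using d(4) by (simp add: w algebra_simps)
    moreover have "k *\<^sub>R z + x \<in> cone_plus L W"
      using d z by (intro cone_plus_add[OF L] cone_plus_scale[OF L])
    moreover have "d + k * f > 0" using d f by (simp add: add_pos_nonneg)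
    ultimately show "\<exists>e>0. v - e *\<^sub>R p \<in> cone_plus L W" by metis
  qed
  have "z \<in> span (insert p L)"
  proof -
    obtain u l where "l \<in> L" "z = (\<Sum>w\<in>W. u w *\<^sub>R w) + l" using z by (auto simp: cone_plus_def)
    then show ?thesis using W by (metis (no_types, lifting) span_add span_base span_scale span_sum
        insertI2 subset_iff)
  qed
  then have "w \<in> span (insert p L)"
    unfolding w by (intro span_add span_scale) (auto intro: span_base)
  then show ?case using W by simp
qed simp

text \<open>The ambient space may be infinite-dimensional, and \<open>dim\<close> is the
  \<open>card\<close> of a basis; finiteness of \<open>S\<close> keeps that \<open>card\<close> from
  defaulting to 0.\<close>

lemma dim_insert_finite_span:
  assumes S: "finite S" and a: "a \<notin> span S"
  shows "dim (insert a S) = Suc (dim S)"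
proof -
  obtain B where B: "B \<subseteq> S" "independent B" "S \<subseteq> span B" "card B = dim S"
    using basis_exists by blast
  have "span B = span S" using B by (metis span_mono span_minimal subset_antisym subspace_span)
  then have "independent (insert a B)" using a B by (simp add: independent_insert)
  moreover have "span (insert a B) = span (insert a S)"
    using \<open>span B = span S\<close> by (simp add: span_insert)
  ultimately have "dim (insert a S) = card (insert a B)" by (metis dim_eq_card)
  moreover have "a \<notin> B" using a B span_base by blast
  moreover have "finite B" using B S finite_subset by blast
  ultimately show ?thesis using B by simp
qed

text \<open>The facet is found as a maximal face \<open>F\<close> that contains \<open>G\<close> and avoids \<open>p\<close>. Seen from the
  barycentre \<open>z\<close> of \<open>F\<close>, maximality makes every vertex direction outside \<open>F\<close> dominate a positive
  multiple of \<open>p - z\<close>, which forces \<open>P\<close> to have only one dimension more than \<open>F\<close>.\<close>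
proposition polytope_facet_separating_point:
  assumes P: "polytope P" and G: "G face_of P" "G \<noteq> {}" and p: "p \<in> P" "p \<notin> G"
  shows "\<exists>F. is_facet F P \<and> G \<subseteq> F \<and> p \<notin> F"
proof -
  obtain V where V: "finite V" and PV: "P = convex hull V" using P by (auto simp: polytope_def)
  have cP: "convex P" by (simp add: PV)
  define \<F> where "\<F> = {F. F face_of P \<and> G \<subseteq> F \<and> p \<notin> F}"
  have "finite \<F>" unfolding \<F>_def PV
    by (rule finite_subset[OF _ finite_faces_convex_hull[OF V]]) auto
  moreover have "G \<in> \<F>" using G p by (simp add: \<F>_def)
  ultimately obtain F where F: "F \<in> \<F>" and Fmax: "\<And>T. T \<in> \<F> \<Longrightarrow> F \<subseteq> T \<Longrightarrow> T = F"
    using finite_has_maximal2[of \<F> G] by blast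
  have FP: "F face_of P" and GF: "G \<subseteq> F" and pF: "p \<notin> F" using F by (auto simp: \<F>_def)
  have FsubP: "F \<subseteq> P" using FP by (simp add: face_of_imp_subset)
  define S where "S = V \<inter> F"
  have FS: "F = convex hull S" unfolding S_def
    using face_of_convex_hull_finite[OF V] FP PV by simp
  have S: "finite S" "S \<noteq> {}"
    unfolding atomize_conj using V G(2) GF FS by (metis S_def convex_hull_empty finite_Int subset_empty)
  define z where "z = (1 / real (card S)) *\<^sub>R \<Sum>S"
  define D where "D = (\<lambda>s. s - z) ` S"
  define L where "L = span D"
  have L: "subspace L" by (simp add: L_def)
  have feas: "d \<in> feasible_directions F z" if "d \<in> L" for d
    using span_feasible_at_mean[OF S] that unfolding L_def D_def z_def FS by blast
  have "z = (\<Sum>s\<in>S. (1 / real (card S)) *\<^sub>R s)" by (simp add: z_def scaleR_sum_right)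
  moreover have "\<dots> \<in> convex hull S"
    using S by (intro convex_sum) (auto simp: hull_inc)
  ultimately have zF: "z \<in> F" by (simp add: FS)
  then have zP: "z \<in> P" using FsubP by blast
  have FL: "x - z \<in> L" if "x \<in> F" for x
  proof -
    have "convex ((+) z ` L)" using L by (simp add: convex_translation subspace_imp_convex)
    moreover have "S \<subseteq> (+) z ` L"
    proof
      fix s assume "s \<in> S"
      then have "s - z \<in> L" by (auto simp: L_def D_def intro: span_base)
      then show "s \<in> (+) z ` L" by (rule rev_image_eqI) simp
    qed
    ultimately have "F \<subseteq> (+) z ` L" unfolding FS by (rule hull_minimal[rotated])
    then show ?thesis using that by auto
  qed
  \<comment> \<open>Here \<open>z\<close> lies strictly between \<open>x\<close> and the overshoot
    point, so a face through \<open>z\<close> contains both ends.\<close>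
  have opp: "x \<in> T" if T: "T face_of P" "z \<in> T" and x: "x \<in> P"
      and e: "z + e *\<^sub>R (z - x) \<in> P" "e > 0" for x e T
  proof (cases "x = z")
    case False
    define y where "y = z + e *\<^sub>R (z - x)"
    have y: "y - x = (1 + e) *\<^sub>R (z - x)" by (simp add: y_def algebra_simps)
    have "x \<noteq> y" using y False e by auto
    moreover have "z = x + (1 / (1 + e)) *\<^sub>R (y - x)" using e by (simp add: y)
    then have "z = (1 - 1 / (1 + e)) *\<^sub>R x + (1 / (1 + e)) *\<^sub>R y" by (simp add: algebra_simps)
    ultimately have "z \<in> open_segment x y" using e
      by (auto simp: in_segment intro!: exI[of _ "1 / (1 + e)"])
    then show ?thesis using T x e by (auto simp: y_def dest: face_ofD)
  qed (use T in simp)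
  define W where "W = (\<lambda>v. v - z) ` (V - F)"
  have W: "finite W" using V by (simp add: W_def)
  have PW: "x - z \<in> cone_plus L W" if "x \<in> P" for x
  proof -
    have "convex {x. x - z \<in> cone_plus L W}"
    proof (rule convexI)
      fix x y and s t :: real
      assume *: "x \<in> {x. x - z \<in> cone_plus L W}" "y \<in> {x. x - z \<in> cone_plus L W}" "0 \<le> s" "0 \<le> t"
        and st: "s + t = 1"
      then have "s *\<^sub>R (x - z) + t *\<^sub>R (y - z) \<in> cone_plus L W"
        by (intro cone_plus_add[OF L] cone_plus_scale[OF L]) auto
      also have "s *\<^sub>R (x - z) + t *\<^sub>R (y - z) = s *\<^sub>R x + t *\<^sub>R y - (s + t) *\<^sub>R z"
        by (simp add: algebra_simps)
      finally show "s *\<^sub>R x + t *\<^sub>R y \<in> {x. x - z \<in> cone_plus L W}" using st by simp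
    qed
    moreover have "V \<subseteq> {x. x - z \<in> cone_plus L W}"
      using FL cone_plus_superset[of L W] cone_plus_generator[OF L W] by (auto simp: W_def)
    ultimately have "P \<subseteq> {x. x - z \<in> cone_plus L W}" unfolding PV by (rule hull_minimal[rotated])
    then show ?thesis using that by auto
  qed
  \<comment> \<open>Otherwise \<open>P\<close> would extend beyond \<open>z\<close> on the side
    opposite to \<open>p\<close>, and \<open>opp\<close> would place \<open>p\<close> in
    \<open>F\<close>.\<close>
  have np: "- (p - z) \<notin> cone_plus L W"
  proof
    assume "- (p - z) \<in> cone_plus L W"
    then obtain u l where ul: "\<forall>w\<in>W. 0 \<le> u w" "l \<in> L" "- (p - z) = (\<Sum>w\<in>W. u w *\<^sub>R w) + l"
      by (auto simp: cone_plus_def)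
    have "w \<in> feasible_directions P z" if "w \<in> W" for w
      using that by (auto simp: W_def feasible_directions_def PV hull_inc intro!: exI[of _ 1])
    moreover have "l \<in> feasible_directions P z"
      using feas[OF ul(2)] FsubP by (auto simp: feasible_directions_def)
    ultimately have "- (p - z) \<in> feasible_directions P z"
      unfolding ul(3) using ul(1)
      by (intro feasible_directions_add[OF cP] feasible_directions_sum[OF cP zP W]
          feasible_directions_scale[OF zP]) auto
    then obtain e where "e > 0" "z + e *\<^sub>R (z - p) \<in> P" by (auto simp: feasible_directions_def)
    then show False using opp[OF FP zF p(1)] pF by blast
  qed
  have W': "W \<subseteq> span (insert (p - z) L)"
  proof (rule cone_plus_spanned_by_dominated[OF L W np])
    fix w assume "w \<in> W"
    then obtain v where v: "v \<in> V" "v \<notin> F" and w: "w = v - z" by (auto simp: W_def)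
    have vP: "v \<in> P" using v by (simp add: PV hull_inc)
    have vz: "v \<noteq> z" using v zF by auto
    \<comment> \<open>The smallest face \<open>T\<close> through \<open>m\<close> contains
      \<open>z\<close> and \<open>v\<close>, hence all of \<open>F\<close> and more. By maximality
      of \<open>F\<close> it contains \<open>p\<close>, so \<open>P\<close> extends beyond
      \<open>m\<close> away from \<open>p\<close>.\<close>
    define m where "m = midpoint z v"
    define T where "T = {x \<in> P. \<exists>e>0. m + e *\<^sub>R (m - x) \<in> P}"
    have T: "T face_of P" unfolding T_def by (rule convex_minimal_face[OF cP])
    have mseg: "m \<in> open_segment z v" using vz by (simp add: m_def)
    then have "m \<in> closed_segment z v" by (simp add: open_segment_def)
    then have "m \<in> P" using closed_segment_subset[OF zP vP cP] by blast
    then have "m \<in> T" by (auto simp: T_def intro: exI[of _ 1])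
    then have zT: "z \<in> T" and vT: "v \<in> T" using face_ofD[OF T mseg zP vP] by auto
    have "F \<subseteq> T"
    proof
      fix x assume x: "x \<in> F"
      have "- (x - z) \<in> L" using FL[OF x] L by (rule subspace_neg[rotated])
      from feas[OF this] obtain e where "e > 0" "z + e *\<^sub>R (z - x) \<in> P"
        using FsubP by (auto simp: feasible_directions_def)
      then show "x \<in> T" using opp[OF T zT] x FsubP by blast
    qed
    then have "T \<notin> \<F>" using Fmax vT v by blast
    then have "p \<in> T" using T GF \<open>F \<subseteq> T\<close> by (auto simp: \<F>_def)
    then obtain e where e: "e > 0" "m + e *\<^sub>R (m - p) \<in> P" by (auto simp: T_def)
    define y where "y = m + e *\<^sub>R (m - p)"
    have "m = z + (1 / 2) *\<^sub>R w" by (simp add: m_def w midpoint_def algebra_simps flip: scaleR_left_distrib)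
    then have yz: "y - z = ((1 + e) / 2) *\<^sub>R w - e *\<^sub>R (p - z)"
      by (simp add: y_def algebra_simps add_divide_distrib)
    \<comment> \<open>The factor normalises the coefficient of \<open>w\<close> to 1.\<close>
    have "(2 / (1 + e)) *\<^sub>R (y - z) \<in> cone_plus L W"
      using e PW by (intro cone_plus_scale[OF L]) (auto simp: y_def)
    also have "(2 / (1 + e)) *\<^sub>R (y - z) = w - (2 * e / (1 + e)) *\<^sub>R (p - z)"
    proof -
      have "2 / (1 + e) * ((1 + e) / 2) = 1" using e(1) by simp
      then show ?thesis unfolding yz
        by (simp only: scaleR_right_diff_distrib scaleR_scaleR scaleR_one) simp
    qed
    finally have "w - (2 * e / (1 + e)) *\<^sub>R (p - z) \<in> cone_plus L W" .
    moreover have "2 * e / (1 + e) > 0" using e by simp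
    ultimately show "\<exists>e>0. w - e *\<^sub>R (p - z) \<in> cone_plus L W" by blast
  qed
  have PX: "x - z \<in> span (insert (p - z) D)" if x: "x \<in> P" for x
  proof -
    have eq: "span (insert (p - z) L) = span (insert (p - z) D)"
      by (simp add: L_def span_insert span_span)
    obtain u l where ul: "l \<in> L" "x - z = (\<Sum>w\<in>W. u w *\<^sub>R w) + l"
      using PW[OF x] by (auto simp: cone_plus_def)
    have "l \<in> span (insert (p - z) L)" using ul by (simp add: span_base)
    then have "x - z \<in> span (insert (p - z) L)" unfolding ul(2) using W'
      by (intro span_add span_sum span_scale) auto
    then show ?thesis by (simp add: eq)
  qed
  \<comment> \<open>\<open>D\<close> spans the directions within \<open>F\<close>, and those within
    \<open>P\<close> need only \<open>p - z\<close> in addition: this is the drop of one in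
    \<open>affdim\<close>.\<close>
  have spanF: "span {x - y | x y. x \<in> F \<and> y \<in> F} = span D"
  proof (rule span_eq[THEN iffD2], intro conjI subsetI)
    fix d assume "d \<in> {x - y | x y. x \<in> F \<and> y \<in> F}"
    then obtain x y where "x \<in> F" "y \<in> F" "d = (x - z) - (y - z)" by auto
    then show "d \<in> span D" using FL unfolding L_def by (metis span_diff)
  next
    fix d assume "d \<in> D"
    then show "d \<in> span {x - y | x y. x \<in> F \<and> y \<in> F}"
      using zF by (auto simp: D_def S_def intro!: span_base)
  qed
  have spanP: "span {x - y | x y. x \<in> P \<and> y \<in> P} = span (insert (p - z) D)"
  proof (rule span_eq[THEN iffD2], intro conjI subsetI)
    fix d assume "d \<in> {x - y | x y. x \<in> P \<and> y \<in> P}"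
    then obtain x y where "x \<in> P" "y \<in> P" "d = (x - z) - (y - z)" by auto
    then show "d \<in> span (insert (p - z) D)" using PX by (metis span_diff)
  next
    fix d assume "d \<in> insert (p - z) D"
    then show "d \<in> span {x - y | x y. x \<in> P \<and> y \<in> P}"
      using zP p FsubP by (auto simp: D_def S_def intro!: span_base)
  qed
  have "p - z \<notin> span D"
  proof
    assume "p - z \<in> span D"
    then have "- (p - z) \<in> L" using L unfolding L_def by (blast intro: span_neg)
    then show False using np cone_plus_superset by blast
  qed
  then have "dim (insert (p - z) D) = Suc (dim D)"
    using S by (intro dim_insert_finite_span) (auto simp: D_def)
  moreover have "dim {x - y | x y. x \<in> F \<and> y \<in> F} = dim D" by (rule span_eq_dim[OF spanF])
  moreover have "dim {x - y | x y. x \<in> P \<and> y \<in> P} = dim (insert (p - z) D)"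
    by (rule span_eq_dim[OF spanP])
  ultimately have "affdim F = affdim P - 1"
    using zF zP by (auto simp: affdim_def)
  then show ?thesis using FP GF pF zF by (auto simp: is_facet_def)
qed

section \<open>Rectangle covers of the disjointness relation\<close>

definition disjoint_pairs :: "'a set set \<Rightarrow> 'a set set \<Rightarrow> ('a set \<times> 'a set) set" where
  "disjoint_pairs A B = {(a, b). a \<in> A \<and> b \<in> B \<and> a \<inter> b = {}}"

lemma finite_disjoint_pairs [simp]: "finite A \<Longrightarrow> finite B \<Longrightarrow> finite (disjoint_pairs A B)"
  by (rule finite_subset[of _ "A \<times> B"]) (auto simp: disjoint_pairs_def)

text \<open>Each element of \<open>N\<close> lies in the first set, in the second, or in
  neither.\<close>

lemma card_disjoint_pairs_Pow:
  assumes "finite N"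
  shows "card (disjoint_pairs (Pow N) (Pow N)) = 3 ^ card N"
  using assms
proof (induction N)
  case empty
  have "disjoint_pairs (Pow {}) (Pow {}) = {({}, {} :: 'a set)}"
    by (auto simp: disjoint_pairs_def)
  then show ?case by simp
next
  case (insert x N)
  let ?D = "disjoint_pairs (Pow N) (Pow N)"
  let ?f = "\<lambda>(a, b). (insert x a, b)" and ?g = "\<lambda>(a, b). (a, insert x b)"
  have eq: "disjoint_pairs (Pow (insert x N)) (Pow (insert x N)) = ?D \<union> ?f ` ?D \<union> ?g ` ?D"
  proof
    show "?D \<union> ?f ` ?D \<union> ?g ` ?D \<subseteq> disjoint_pairs (Pow (insert x N)) (Pow (insert x N))"
      using insert.hyps by (auto simp: disjoint_pairs_def)
    show "disjoint_pairs (Pow (insert x N)) (Pow (insert x N)) \<subseteq> ?D \<union> ?f ` ?D \<union> ?g ` ?D"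
    proof
      fix z assume "z \<in> disjoint_pairs (Pow (insert x N)) (Pow (insert x N))"
      then obtain a b where z: "z = (a, b)" and ab: "a \<subseteq> insert x N" "b \<subseteq> insert x N" "a \<inter> b = {}"
        by (auto simp: disjoint_pairs_def)
      consider "x \<in> a" | "x \<in> b" | "x \<notin> a" "x \<notin> b" by blast
      then show "z \<in> ?D \<union> ?f ` ?D \<union> ?g ` ?D"
      proof cases
        case 1
        then have "(a - {x}, b) \<in> ?D" using ab by (auto simp: disjoint_pairs_def)
        moreover have "z = ?f (a - {x}, b)" using 1 z by auto
        ultimately show ?thesis by blast
      next
        case 2
        then have "(a, b - {x}) \<in> ?D" using ab by (auto simp: disjoint_pairs_def)
        moreover have "z = ?g (a, b - {x})" using 2 z by auto
        ultimately show ?thesis by blast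
      next
        case 3
        then have "z \<in> ?D" using ab z by (auto simp: disjoint_pairs_def)
        then show ?thesis by blast
      qed
    qed
  qed
  have fin: "finite ?D" using insert.hyps by simp
  have "card (?f ` ?D) = card ?D"
    using insert.hyps
    by (intro card_image inj_on_inverseI[where g = "\<lambda>(a, b). (a - {x}, b)"])
      (auto simp: disjoint_pairs_def)
  moreover have "card (?g ` ?D) = card ?D"
    using insert.hyps
    by (intro card_image inj_on_inverseI[where g = "\<lambda>(a, b). (a, b - {x})"])
      (auto simp: disjoint_pairs_def)
  moreover have "?D \<inter> ?f ` ?D = {}" "(?D \<union> ?f ` ?D) \<inter> ?g ` ?D = {}"
    using insert.hyps by (auto simp: disjoint_pairs_def)
  ultimately have "card (?D \<union> ?f ` ?D \<union> ?g ` ?D) = card ?D + card ?D + card ?D"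
    using fin by (simp add: card_Un_disjoint)
  then show ?case unfolding eq using insert by simp
qed

text \<open>Following Kaibel and Weltge: sort the pairs by the membership of \<open>x\<close> in \<open>a\<close> and \<open>b\<close>. After
  deletion of \<open>x\<close>, a disjoint pair of subsets of \<open>N\<close> arises at most twice, because
  \<open>(insert x a, insert x b)\<close> would meet in one element, and two rectangles over \<open>N\<close> suffice to
  accommodate the images.\<close>
lemma card_disjoint_pairs_rectangle:
  assumes "finite N" "A \<subseteq> Pow N" "B \<subseteq> Pow N"
    and "\<And>a b. a \<in> A \<Longrightarrow> b \<in> B \<Longrightarrow> card (a \<inter> b) \<noteq> 1"
  shows "card (disjoint_pairs A B) \<le> 2 ^ card N"
  using assms
proof (induction N arbitrary: A B)
  case empty
  then have "disjoint_pairs A B \<subseteq> {({}, {})}" by (auto simp: disjoint_pairs_def)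
  from card_mono[OF _ this] show ?case by simp
next
  case (insert x N)
  \<comment> \<open>In \<open>A1\<close>, \<open>B0\<close> and in \<open>A0\<close>,
    \<open>B1\<close> one side avoids \<open>x\<close>, so deleting \<open>x\<close> on the other
    side changes no intersection and the induction hypothesis applies.\<close>
  define A0 where "A0 = {a \<in> A. x \<notin> a}"
  define A1 where "A1 = (\<lambda>a. a - {x}) ` A"
  define B0 where "B0 = {b \<in> B. x \<notin> b}"
  define B1 where "B1 = (\<lambda>b. b - {x}) ` B"
  have sub: "A0 \<subseteq> Pow N" "A1 \<subseteq> Pow N" "B0 \<subseteq> Pow N" "B1 \<subseteq> Pow N"
    using insert.prems(1,2) by (auto simp: A0_def A1_def B0_def B1_def)
  have fin: "finite A0" "finite A1" "finite B0" "finite B1" "finite A" "finite B"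
    using insert.hyps insert.prems(1,2) by (auto simp: A0_def A1_def B0_def B1_def intro: finite_subset)
  let ?X = "disjoint_pairs A1 B0" and ?Y = "disjoint_pairs A0 B1"
  let ?D = "disjoint_pairs A B"
  have X: "card ?X \<le> 2 ^ card N"
  proof (rule insert.IH[OF sub(2,3)])
    fix a b assume "a \<in> A1" "b \<in> B0"
    then obtain c where c: "c \<in> A" "a = c - {x}" and b: "b \<in> B" "x \<notin> b"
      by (auto simp: A1_def B0_def)
    then have "a \<inter> b = c \<inter> b" by auto
    then show "card (a \<inter> b) \<noteq> 1" using insert.prems(3) c b by simp
  qed
  have Y: "card ?Y \<le> 2 ^ card N"
  proof (rule insert.IH[OF sub(1,4)])
    fix a b assume "a \<in> A0" "b \<in> B1"
    then obtain c where c: "c \<in> B" "b = c - {x}" and a: "a \<in> A" "x \<notin> a"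
      by (auto simp: B1_def A0_def)
    then have "a \<inter> b = a \<inter> c" by auto
    then show "card (a \<inter> b) \<noteq> 1" using insert.prems(3) c a by simp
  qed
  \<comment> \<open>Pairs with \<open>x\<close> in neither set are distributed according to whether
    \<open>insert x a\<close> is in \<open>A\<close>; this makes each deletion map injective on its
    part.\<close>
  define D1 where "D1 = {(a, b) \<in> ?D. x \<in> a \<or> (x \<notin> b \<and> insert x a \<notin> A)}"
  define D2 where "D2 = {(a, b) \<in> ?D. x \<notin> a \<and> (x \<in> b \<or> insert x a \<in> A)}"
  have "card D1 \<le> card ?X"
  proof (rule card_inj_on_le)
    show "inj_on (\<lambda>(a, b). (a - {x}, b)) D1"
    proof (rule inj_onI)
      fix p q assume pq: "p \<in> D1" "q \<in> D1"
        and eq: "(case p of (a, b) \<Rightarrow> (a - {x}, b)) = (case q of (a, b) \<Rightarrow> (a - {x}, b))"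
      obtain a b a' where ab: "p = (a, b)" "q = (a', b)" using eq by (cases p; cases q) auto
      then have D: "(a, b) \<in> D1" "(a', b) \<in> D1" and e: "a - {x} = a' - {x}" using pq eq by auto
      have "a \<in> A" "a' \<in> A" using D by (auto simp: D1_def disjoint_pairs_def)
      moreover have "x \<in> a \<Longrightarrow> x \<notin> a' \<Longrightarrow> a = insert x a'"
        "x \<in> a' \<Longrightarrow> x \<notin> a \<Longrightarrow> a' = insert x a" using e by auto
      ultimately have "x \<in> a \<longleftrightarrow> x \<in> a'" using D by (auto simp: D1_def)
      then show "p = q" using e ab by auto
    qed
    show "(\<lambda>(a, b). (a - {x}, b)) ` D1 \<subseteq> ?X"
      by (auto simp: D1_def disjoint_pairs_def A1_def B0_def)
  qed (use fin in simp)
  moreover have "card D2 \<le> card ?Y"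
  proof (rule card_inj_on_le)
    show "inj_on (\<lambda>(a, b). (a, b - {x})) D2"
    proof (rule inj_onI)
      fix p q assume pq: "p \<in> D2" "q \<in> D2"
        and eq: "(case p of (a, b) \<Rightarrow> (a, b - {x})) = (case q of (a, b) \<Rightarrow> (a, b - {x}))"
      obtain a b b' where ab: "p = (a, b)" "q = (a, b')" using eq by (cases p; cases q) auto
      then have D: "(a, b) \<in> D2" "(a, b') \<in> D2" and e: "b - {x} = b' - {x}" using pq eq by auto
      \<comment> \<open>As \<open>x \<notin> b'\<close>, the second pair is in \<open>D2\<close>
        because \<open>insert x a \<in> A\<close>; but \<open>insert x a\<close> meets
        \<open>b\<close> in \<open>x\<close> alone, which is excluded.\<close>
      have *: False if D: "(a, b) \<in> D2" "(a, b') \<in> D2" and x: "x \<in> b" "x \<notin> b'" for b b'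
      proof -
        have "insert x a \<in> A" "b \<in> B" "a \<inter> b = {}"
          using D x by (auto simp: D2_def disjoint_pairs_def)
        moreover from this x have "insert x a \<inter> b = {x}" by auto
        ultimately show False using insert.prems(3)[of "insert x a" b] by simp
      qed
      show "p = q" using *[OF D] *[OF D(2,1)] e ab by auto
    qed
    show "(\<lambda>(a, b). (a, b - {x})) ` D2 \<subseteq> ?Y"
      by (auto simp: D2_def disjoint_pairs_def A0_def B1_def)
  qed (use fin in simp)
  moreover have "?D \<subseteq> D1 \<union> D2" by (auto simp: D1_def D2_def)
  then have "card ?D \<le> card (D1 \<union> D2)"
    by (intro card_mono finite_subset[of "D1 \<union> D2" ?D]) (use fin in \<open>auto simp: D1_def D2_def\<close>)
  then have "card ?D \<le> card D1 + card D2" using card_Un_le[of D1 D2] by linarith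
  ultimately show ?case using X Y insert.hyps by simp
qed

proposition disjointness_rectangle_cover:
  assumes N: "finite N" and I: "finite I"
    and sub: "\<And>i. i \<in> I \<Longrightarrow> A i \<subseteq> Pow N" "\<And>i. i \<in> I \<Longrightarrow> B i \<subseteq> Pow N"
    and rect: "\<And>i a b. i \<in> I \<Longrightarrow> a \<in> A i \<Longrightarrow> b \<in> B i \<Longrightarrow> card (a \<inter> b) \<noteq> 1"
    and cover: "\<And>a b. a \<subseteq> N \<Longrightarrow> b \<subseteq> N \<Longrightarrow> a \<inter> b = {} \<Longrightarrow> \<exists>i\<in>I. a \<in> A i \<and> b \<in> B i"
  shows "3 ^ card N \<le> card I * 2 ^ card N"
proof -
  have fin: "finite (A i)" "finite (B i)" if "i \<in> I" for i
    using sub[OF that] N by (auto intro: finite_subset)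
  have "disjoint_pairs (Pow N) (Pow N) \<subseteq> (\<Union>i\<in>I. disjoint_pairs (A i) (B i))"
    using cover by (fastforce simp: disjoint_pairs_def)
  then have "3 ^ card N \<le> card (\<Union>i\<in>I. disjoint_pairs (A i) (B i))"
    unfolding card_disjoint_pairs_Pow[OF N, symmetric]
    by (rule card_mono[rotated]) (use I fin in auto)
  also have "\<dots> \<le> (\<Sum>i\<in>I. card (disjoint_pairs (A i) (B i)))" by (rule card_UN_le[OF I])
  also have "\<dots> \<le> (\<Sum>i\<in>I. 2 ^ card N)"
    by (intro sum_mono card_disjoint_pairs_rectangle[OF N]) (use sub rect in auto)
  finally show ?thesis by simp
qed

section \<open>A lower bound on the extension complexity\<close>

text \<open>A proper weighted average of two values at most \<open>r\<close> equals \<open>r\<close>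
  only if both do.\<close>

lemma face_of_supporting_functional:
  assumes "convex P" "linear \<phi>" and le: "\<And>x. x \<in> P \<Longrightarrow> \<phi> x \<le> (r::real)"
  shows "{x \<in> P. \<phi> x = r} face_of P"
proof -
  interpret linear \<phi> by fact
  have "convex {x. \<phi> x = r}"
    by (auto simp: convex_def add scale simp flip: distrib_right)
  then have "convex {x \<in> P. \<phi> x = r}" using assms(1) by (simp add: Collect_conj_eq convex_Int)
  moreover have "\<phi> a = r" if "a \<in> P" "b \<in> P" "\<phi> x = r" "x \<in> open_segment a b" for a b x
  proof (rule antisym)
    obtain u where u: "0 < u" "u < 1" "x = (1 - u) *\<^sub>R a + u *\<^sub>R b"
      using \<open>x \<in> open_segment a b\<close> by (auto simp: in_segment)
    then have "r = (1 - u) * \<phi> a + u * \<phi> b" using \<open>\<phi> x = r\<close> by (simp add: add scale)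
    also have "\<dots> \<le> (1 - u) * \<phi> a + u * r" using u le[OF \<open>b \<in> P\<close>] by simp
    finally have "(1 - u) * r \<le> (1 - u) * \<phi> a" by (simp add: algebra_simps)
    then show "r \<le> \<phi> a" using u by simp
  qed (use le that in auto)
  ultimately show ?thesis unfolding face_of_def using open_segment_commute by blast
qed

text \<open>Ensures that \<open>card\<close> of the facets is a true count rather than the default 0
  of an infinite set.\<close>

lemma finite_facets:
  assumes "polytope P"
  shows "finite {F. is_facet F P}"
proof -
  obtain V where "finite V" "P = convex hull V" using assms by (auto simp: polytope_def)
  then show ?thesis
    by (intro finite_subset[OF _ finite_faces_convex_hull[of V]]) (auto simp: is_facet_def)
qed

text \<open>A simplex on \<open>n\<close> unit vectors maps onto the hull of \<open>n\<close>
  points. Hence the \<open>LEAST\<close> in \<open>ext_complexity\<close> ranges over a nonempty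
  set.\<close>

lemma extension_exists:
  fixes X :: "'b::real_vector set"
  assumes "finite X"
  shows "\<exists>(P :: (nat \<Rightarrow> real) set) f. polytope P \<and> linear f \<and> f ` P = convex hull X"
proof -
  obtain g :: "nat \<Rightarrow> 'b" and n where g: "X = g ` {i. i < n}"
    using finite_imp_nat_seg_image_inj_on[OF assms] by blast
  define e :: "nat \<Rightarrow> nat \<Rightarrow> real" where "e i = indicator {i}" for i
  define f :: "(nat \<Rightarrow> real) \<Rightarrow> 'b" where "f v = (\<Sum>i<n. v i *\<^sub>R g i)" for v
  have f: "linear f"
    by (rule linearI)
      (simp_all add: f_def scaleR_fun_def sum.distrib scaleR_left_distrib scaleR_sum_right)
  have "f (e j) = g j" if "j < n" for j
  proof -
    have "f (e j) = (\<Sum>i<n. if i = j then g j else 0)"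
      unfolding f_def e_def by (rule sum.cong) (auto simp: indicator_def)
    then show ?thesis using that by simp
  qed
  then have "f ` e ` {..<n} = X" unfolding g by (force simp: image_image)
  then have "f ` (convex hull (e ` {..<n})) = convex hull X"
    using f by (simp add: convex_hull_linear_image)
  moreover have "polytope (convex hull (e ` {..<n}))" unfolding polytope_def by blast
  ultimately show ?thesis using f by blast
qed

lemma ext_complexity_attained:
  assumes "finite X"
  obtains P f where "polytope (P :: (nat \<Rightarrow> real) set)" "linear f" "f ` P = convex hull X"
    "card {F. is_facet F P} = ext_complexity (convex hull X)"
proof -
  let ?Q = "\<lambda>k. \<exists>(P :: (nat \<Rightarrow> real) set) f.
      polytope P \<and> linear f \<and> f ` P = convex hull X \<and> card {F. is_facet F P} = k"
  have "\<exists>k. ?Q k" using extension_exists[OF assms] by blast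
  then have "?Q (LEAST k. ?Q k)" by (rule LeastI_ex)
  then show ?thesis using that unfolding ext_complexity_def by blast
qed

text \<open>The \<open>+ 1\<close> accounts for an additional rectangle that covers the row of the empty set, whose
  face may be empty.\<close>
proposition ext_complexity_disjointness:
  fixes X :: "'b::real_vector set" and \<phi> :: "'n set \<Rightarrow> 'b \<Rightarrow> real"
  assumes X: "finite X" and N: "finite N"
    and lin: "\<And>a. a \<subseteq> N \<Longrightarrow> linear (\<phi> a)"
    and valid: "\<And>a x. a \<subseteq> N \<Longrightarrow> x \<in> X \<Longrightarrow> \<phi> a x \<le> r a"
    and y: "\<And>b. b \<subseteq> N \<Longrightarrow> y b \<in> X"
    and tight: "\<And>a b. a \<subseteq> N \<Longrightarrow> b \<subseteq> N \<Longrightarrow> card (a \<inter> b) = 1 \<Longrightarrow> \<phi> a (y b) = r a"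
    and slack: "\<And>a b. a \<subseteq> N \<Longrightarrow> b \<subseteq> N \<Longrightarrow> a \<inter> b = {} \<Longrightarrow> \<phi> a (y b) < r a"
  shows "3 ^ card N \<le> (ext_complexity (convex hull X) + 1) * 2 ^ card N"
proof -
  obtain P f where P: "polytope (P :: (nat \<Rightarrow> real) set)" and f: "linear f"
    and fP: "f ` P = convex hull X" and k: "card {F. is_facet F P} = ext_complexity (convex hull X)"
    using ext_complexity_attained[OF X] .
  have cP: "convex P" using P by (auto simp: polytope_def)
  have "\<exists>x\<in>P. f x = y b" if "b \<subseteq> N" for b
  proof -
    have "y b \<in> f ` P" unfolding fP using y[OF that] by (rule hull_inc)
    then show ?thesis by auto
  qed
  then obtain x where x: "\<And>b. b \<subseteq> N \<Longrightarrow> x b \<in> P" "\<And>b. b \<subseteq> N \<Longrightarrow> f (x b) = y b" by metis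
  define G where "G a = {z \<in> P. \<phi> a (f z) = r a}" for a
  have G: "G a face_of P" if a: "a \<subseteq> N" for a
    unfolding G_def
  proof (rule face_of_supporting_functional[OF cP])
    show "linear (\<lambda>z. \<phi> a (f z))" using linear_compose[OF f lin[OF a]] by (simp add: o_def)
    have "convex {z. \<phi> a z \<le> r a}"
    proof -
      interpret linear "\<phi> a" using lin[OF a] .
      show ?thesis unfolding convex_def by (auto simp: add scale intro: convex_bound_le)
    qed
    then have "convex hull X \<subseteq> {z. \<phi> a z \<le> r a}" using valid[OF a] by (intro hull_minimal) auto
    then show "\<phi> a (f z) \<le> r a" if "z \<in> P" for z using that fP by blast
  qed
  define \<F> where "\<F> = {F. is_facet F P}"
  have "finite \<F>" unfolding \<F>_def by (rule finite_facets[OF P])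
  \<comment> \<open>\<open>Some F\<close> stands for the rectangle of the facet \<open>F\<close>,
    and \<open>None\<close> for the additional one.\<close>
  define A where "A i = (case i of None \<Rightarrow> {{}} | Some F \<Rightarrow> {a. a \<subseteq> N \<and> G a \<subseteq> F})" for i
  define B where "B i = (case i of None \<Rightarrow> Pow N | Some F \<Rightarrow> {b. b \<subseteq> N \<and> x b \<notin> F})" for i
  have "3 ^ card N \<le> card (insert None (Some ` \<F>)) * 2 ^ card N"
  proof (rule disjointness_rectangle_cover[OF N, where A = A and B = B])
    fix i a b assume "i \<in> insert None (Some ` \<F>)" and ab: "a \<in> A i" "b \<in> B i"
    show "card (a \<inter> b) \<noteq> 1"
    proof (cases i)
      case None
      then show ?thesis using ab by (simp add: A_def)
    next
      case (Some F)
      then have *: "a \<subseteq> N" "G a \<subseteq> F" "b \<subseteq> N" "x b \<notin> F" using ab by (auto simp: A_def B_def)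
      then have "x b \<notin> G a" by blast
      then show ?thesis using tight * x by (auto simp: G_def)
    qed
  next
    fix a b assume ab: "a \<subseteq> N" "b \<subseteq> N" "a \<inter> b = {}"
    show "\<exists>i\<in>insert None (Some ` \<F>). a \<in> A i \<and> b \<in> B i"
    proof (cases "a = {}")
      case True
      then show ?thesis using ab by (intro bexI[of _ None]) (auto simp: A_def B_def)
    next
      case False
      then obtain j where j: "j \<in> a" by auto
      \<comment> \<open>The lifted point of the singleton \<open>{j}\<close> shows that
        \<open>G a\<close> is nonempty, as facet separation requires.\<close>
      then have "card (a \<inter> {j}) = 1" by simp
      then have "x {j} \<in> G a" using tight[of a "{j}"] x[of "{j}"] ab j by (auto simp: G_def)
      moreover have "x b \<notin> G a" using slack[OF ab] x ab by (auto simp: G_def)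
      moreover have "x b \<in> P" using x(1) ab(2) .
      ultimately obtain F where "is_facet F P" "G a \<subseteq> F" "x b \<notin> F"
        using polytope_facet_separating_point[OF P G[OF ab(1)], of "x b"] by (metis empty_iff)
      then show ?thesis using ab by (intro bexI[of _ "Some F"]) (auto simp: A_def B_def \<F>_def)
    qed
  qed (use \<open>finite \<F>\<close> in \<open>auto simp: A_def B_def split: option.splits\<close>)
  also have "card (insert None (Some ` \<F>)) = ext_complexity (convex hull X) + 1"
    using \<open>finite \<F>\<close> k by (simp add: card_insert_if card_image \<F>_def)
  finally show ?thesis .
qed

section \<open>Stable sets as a face of a bipartite maximal matching polytope\<close>

text \<open>Every vertex \<open>h\<close> of a graph \<open>(W, R)\<close> is replaced by a path \<open>p\<^sub>h c\<^sub>h d\<^sub>h q\<^sub>h\<close>, encoded as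
  \<open>4 * enc h + {0, 1, 2, 3}\<close>, and every edge \<open>h k\<close> by \<open>p\<^sub>h q\<^sub>k\<close>. If a maximal matching covers all
  \<open>c\<^sub>h\<close>, \<open>d\<^sub>h\<close> and uses no edge \<open>p\<^sub>h q\<^sub>k\<close>, then \<open>p\<^sub>h\<close> and \<open>q\<^sub>h\<close> are exposed exactly when \<open>c\<^sub>h d\<^sub>h\<close> is
  matched, and maximality says that these \<open>h\<close> form a stable set.\<close>
locale path_replacement =
  fixes enc :: "'h \<Rightarrow> nat" and W :: "'h set" and R :: "'h \<Rightarrow> 'h \<Rightarrow> bool"
  assumes inj_enc: "inj enc" and finite_W: "finite W"
begin

definition pc :: "'h \<Rightarrow> nat set" where "pc h = {4 * enc h, 4 * enc h + 1}"
definition cd :: "'h \<Rightarrow> nat set" where "cd h = {4 * enc h + 1, 4 * enc h + 2}"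
definition dq :: "'h \<Rightarrow> nat set" where "dq h = {4 * enc h + 2, 4 * enc h + 3}"
definition pq :: "'h \<Rightarrow> 'h \<Rightarrow> nat set" where "pq h k = {4 * enc h, 4 * enc k + 3}"

definition vertices :: "nat set" where
  "vertices = (\<Union>h\<in>W. {4 * enc h, 4 * enc h + 1, 4 * enc h + 2, 4 * enc h + 3})"

definition cross :: "('h \<times> 'h) set" where
  "cross = {(h, k). h \<in> W \<and> k \<in> W \<and> R h k}"

definition edges :: "nat set set" where
  "edges = pc ` W \<union> cd ` W \<union> dq ` W \<union> (\<lambda>(h, k). pq h k) ` cross"

definition stable :: "'h set \<Rightarrow> bool" where
  "stable S \<longleftrightarrow> S \<subseteq> W \<and> (\<forall>h\<in>S. \<forall>k\<in>S. \<not> R h k)"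

definition matching_of :: "'h set \<Rightarrow> nat set set" where
  "matching_of S = cd ` S \<union> pc ` (W - S) \<union> dq ` (W - S)"

text \<open>The weight of the \<open>cd\<close> edges plus a penalty term. The outer parenthesis
  counts the covered vertices \<open>c\<^sub>h\<close>, \<open>d\<^sub>h\<close> minus the cross
  edges used; on matchings its maximum \<open>2 * card W\<close> singles out the intended
  face.\<close>

definition functional :: "('h \<Rightarrow> real) \<Rightarrow> (nat set \<Rightarrow> real) \<Rightarrow> real" where
  "functional w x = (\<Sum>h\<in>W. w h * x (cd h)) + sum w W *
     ((\<Sum>h\<in>W. x (pc h) + 2 * x (cd h) + x (dq h)) - (\<Sum>(h, k)\<in>cross. x (pq h k)))"

lemma enc_eq: "enc h = enc k \<longleftrightarrow> h = k"
  using inj_enc by (simp add: inj_eq)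

lemma card_vertices: "card vertices \<le> 4 * card W"
proof -
  have "card vertices \<le> (\<Sum>h\<in>W. card {4 * enc h, 4 * enc h + 1, 4 * enc h + 2, 4 * enc h + 3})"
    unfolding vertices_def by (rule card_UN_le[OF finite_W])
  also have "\<dots> \<le> (\<Sum>h\<in>W. 4)"
    by (intro sum_mono) (simp add: card_insert_if)
  finally show ?thesis by simp
qed

text \<open>The codes of \<open>p\<^sub>h\<close> and \<open>d\<^sub>h\<close> are even, those of
  \<open>c\<^sub>h\<close> and \<open>q\<^sub>h\<close> odd.\<close>

lemma bipartite_edges: "bipartite vertices edges"
proof -
  let ?V1 = "{v \<in> vertices. even v}" and ?V2 = "{v \<in> vertices. odd v}"
  have *: "\<exists>u v. u \<in> ?V1 \<and> v \<in> ?V2 \<and> e = {u, v}" if e: "e \<in> edges" for e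
  proof -
    consider h where "h \<in> W" "e = pc h" | h where "h \<in> W" "e = cd h" | h where "h \<in> W" "e = dq h"
      | h k where "h \<in> W" "k \<in> W" "e = pq h k"
      using e unfolding edges_def cross_def by blast
    then show ?thesis
    proof cases
      case 1
      then show ?thesis
        by (intro exI[of _ "4 * enc h"] exI[of _ "4 * enc h + 1"]) (auto simp: pc_def vertices_def)
    next
      case 2
      then show ?thesis
        by (intro exI[of _ "4 * enc h + 2"] exI[of _ "4 * enc h + 1"]) (auto simp: cd_def vertices_def)
    next
      case 3
      then show ?thesis
        by (intro exI[of _ "4 * enc h + 2"] exI[of _ "4 * enc h + 3"]) (auto simp: dq_def vertices_def)
    next
      case 4
      then show ?thesis
        by (intro exI[of _ "4 * enc h"] exI[of _ "4 * enc k + 3"]) (auto simp: pq_def vertices_def)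
    qed
  qed
  have "finite vertices" using finite_W by (simp add: vertices_def)
  moreover have "\<exists>u v. u \<in> vertices \<and> v \<in> vertices \<and> u \<noteq> v \<and> e = {u, v}" if "e \<in> edges" for e
    using *[OF that] by blast
  ultimately have "graph vertices edges" unfolding graph_def by blast
  moreover have "?V1 \<inter> ?V2 = {} \<and> ?V1 \<union> ?V2 = vertices \<and>
      (\<forall>e\<in>edges. \<exists>u v. u \<in> ?V1 \<and> v \<in> ?V2 \<and> e = {u, v})"
    by (intro conjI ballI *) auto
  ultimately show ?thesis unfolding bipartite_def
    by (-) (rule conjI, assumption, rule exI, rule exI, assumption)
qed

lemma finite_cross: "finite cross"
  by (rule finite_subset[of _ "W \<times> W"]) (use finite_W in \<open>auto simp: cross_def\<close>)

lemma finite_edges: "finite edges"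
  using finite_W finite_cross by (simp add: edges_def)

lemma quadruple_code_simps:
  fixes m n :: nat
  shows
  "4 * m = 4 * n \<longleftrightarrow> m = n" "4 * m \<noteq> 4 * n + 1" "4 * m \<noteq> 4 * n + 2" "4 * m \<noteq> 4 * n + 3"
  "4 * m + 1 \<noteq> 4 * n" "4 * m + 1 = 4 * n + 1 \<longleftrightarrow> m = n" "4 * m + 1 \<noteq> 4 * n + 2" "4 * m + 1 \<noteq> 4 * n + 3"
  "4 * m + 2 \<noteq> 4 * n" "4 * m + 2 \<noteq> 4 * n + 1" "4 * m + 2 = 4 * n + 2 \<longleftrightarrow> m = n" "4 * m + 2 \<noteq> 4 * n + 3"
  "4 * m + 3 \<noteq> 4 * n" "4 * m + 3 \<noteq> 4 * n + 1" "4 * m + 3 \<noteq> 4 * n + 2" "4 * m + 3 = 4 * n + 3 \<longleftrightarrow> m = n"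
  by presburger+

lemma edge_Int_simps:
  "pc h \<inter> pc k = {} \<longleftrightarrow> h \<noteq> k" "cd h \<inter> cd k = {} \<longleftrightarrow> h \<noteq> k" "dq h \<inter> dq k = {} \<longleftrightarrow> h \<noteq> k"
  "pc h \<inter> cd k = {} \<longleftrightarrow> h \<noteq> k" "cd h \<inter> pc k = {} \<longleftrightarrow> h \<noteq> k"
  "cd h \<inter> dq k = {} \<longleftrightarrow> h \<noteq> k" "dq h \<inter> cd k = {} \<longleftrightarrow> h \<noteq> k"
  "pc h \<inter> dq k = {}" "dq h \<inter> pc k = {}"
  "pq h g \<inter> pc k = {} \<longleftrightarrow> h \<noteq> k" "pq g h \<inter> dq k = {} \<longleftrightarrow> h \<noteq> k" "pq g h \<inter> cd k = {}"
  unfolding enc_eq[symmetric] pc_def cd_def dq_def pq_def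
  by (simp_all only: Int_insert_left Int_empty_left insert_iff empty_iff quadruple_code_simps) auto

lemma edge_eq_simps:
  "pc h = pc k \<longleftrightarrow> h = k" "cd h = cd k \<longleftrightarrow> h = k" "dq h = dq k \<longleftrightarrow> h = k"
  "pc h \<noteq> cd k" "pc h \<noteq> dq k" "cd h \<noteq> dq k" "cd k \<noteq> pc h" "dq k \<noteq> pc h" "dq k \<noteq> cd h"
  "pq h k \<noteq> pc g" "pq h k \<noteq> cd g" "pq h k \<noteq> dq g"
  unfolding enc_eq[symmetric] pc_def cd_def dq_def pq_def doubleton_eq_iff
  by (simp_all only: quadruple_code_simps) auto

lemma matchingD:
  assumes "matching E M" "e \<in> M" "e' \<in> M" "e \<noteq> e'"
  shows "e \<inter> e' = {}"
  using assms by (auto simp: matching_def)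

lemma matching_of_mem:
  assumes "S \<subseteq> W"
  shows "cd h \<in> matching_of S \<longleftrightarrow> h \<in> S" "pc h \<in> matching_of S \<longleftrightarrow> h \<in> W - S"
    "dq h \<in> matching_of S \<longleftrightarrow> h \<in> W - S" "pq h k \<notin> matching_of S"
  using assms by (auto simp: matching_of_def edge_eq_simps)

text \<open>All \<open>c\<^sub>h\<close> and \<open>d\<^sub>h\<close> are covered, so only an edge
  \<open>p\<^sub>h q\<^sub>k\<close> could be added. Both its ends are exposed only for
  \<open>h\<close> and \<open>k\<close> in \<open>S\<close>, which stability forbids.\<close>

lemma maximal_matching_of:
  assumes S: "stable S"
  shows "maximal_matching edges (matching_of S)"
proof -
  have SW: "S \<subseteq> W" using S by (simp add: stable_def)
  have "matching_of S \<subseteq> edges" using SW by (auto simp: matching_of_def edges_def)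
  moreover have "e \<inter> e' = {}" if "e \<in> matching_of S" "e' \<in> matching_of S" "e \<noteq> e'" for e e'
    using that unfolding matching_of_def
    by (elim UnE imageE; simp add: edge_Int_simps edge_eq_simps; blast)
  ultimately have m: "matching edges (matching_of S)" unfolding matching_def by blast
  have False if M': "matching edges M'" and sub: "matching_of S \<subset> M'" for M'
  proof -
    obtain e where e: "e \<in> M'" "e \<notin> matching_of S" using sub by blast
    have meet: "e \<inter> f = {}" if "f \<in> matching_of S" for f
      using matchingD[OF M' e(1), of f] that sub e(2) by blast
    have "e \<in> edges" using M' e(1) by (auto simp: matching_def)
    then consider h where "h \<in> W" "e = pc h" | h where "h \<in> W" "e = cd h" | h where "h \<in> W" "e = dq h"
      | h k where "h \<in> W" "k \<in> W" "R h k" "e = pq h k"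
      unfolding edges_def cross_def by blast
    then show False
    proof cases
      case (1 h)
      then have "cd h \<in> matching_of S" using e(2) by (simp add: matching_of_mem[OF SW])
      from meet[OF this] show False using 1 by (simp add: edge_Int_simps)
    next
      case (2 h)
      then have "pc h \<in> matching_of S" using e(2) by (simp add: matching_of_mem[OF SW])
      from meet[OF this] show False using 2 by (simp add: edge_Int_simps)
    next
      case (3 h)
      then have "cd h \<in> matching_of S" using e(2) by (simp add: matching_of_mem[OF SW])
      from meet[OF this] show False using 3 by (simp add: edge_Int_simps)
    next
      case (4 h k)
      then consider "h \<notin> S" | "k \<notin> S" using S by (auto simp: stable_def)
      then show False
      proof cases
        case 1
        then have "pc h \<in> matching_of S" using 4 by (simp add: matching_of_mem[OF SW])
        from meet[OF this] show False using 4 by (simp add: edge_Int_simps)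
      next
        case 2
        then have "dq k \<in> matching_of S" using 4 by (simp add: matching_of_mem[OF SW])
        from meet[OF this] show False using 4 by (simp add: edge_Int_simps)
      qed
    qed
  qed
  then show ?thesis using m unfolding maximal_matching_def by blast
qed

lemma linear_functional: "linear (functional w)"
  by (rule linearI)
    (simp_all add: functional_def scaleR_fun_def algebra_simps sum.distrib sum_distrib_left
      case_prod_unfold)

lemma sum_indicator_cd:
  "(\<Sum>h\<in>W. w h * indicator M (cd h)) = (\<Sum>h\<in>{h \<in> W. cd h \<in> M}. w h :: real)"
  unfolding sum.inter_filter[OF finite_W] by (rule sum.cong) (auto simp: indicator_def)

lemma functional_matching_of:
  assumes S: "stable S"
  shows "functional w (incidence_vector (matching_of S)) = sum w S + sum w W * (2 * real (card W))"
proof -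
  have SW: "S \<subseteq> W" using S by (simp add: stable_def)
  let ?x = "indicator (matching_of S) :: nat set \<Rightarrow> real"
  have "(\<Sum>h\<in>W. ?x (pc h) + 2 * ?x (cd h) + ?x (dq h)) = (\<Sum>h\<in>W. 2)"
    by (rule sum.cong) (auto simp: indicator_def matching_of_mem[OF SW])
  moreover have "(\<Sum>(h, k)\<in>cross. ?x (pq h k)) = 0"
    by (rule sum.neutral) (auto simp: matching_of_mem[OF SW])
  moreover have "{h \<in> W. cd h \<in> matching_of S} = S" using SW by (auto simp: matching_of_mem[OF SW])
  ultimately show ?thesis
    unfolding functional_def incidence_vector_def sum_indicator_cd by simp
qed

text \<open>Converse of \<open>maximal_matching_of\<close>: if \<open>R h k\<close> held for two
  chosen vertices, \<open>pq h k\<close> would have exposed ends and could be added to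
  \<open>M\<close>.\<close>

lemma stable_of_maximal_matching:
  assumes M: "maximal_matching edges M"
    and cov: "\<And>h. h \<in> W \<Longrightarrow> cd h \<in> M \<or> pc h \<in> M \<and> dq h \<in> M"
    and cross: "\<And>h k. (h, k) \<in> cross \<Longrightarrow> pq h k \<notin> M"
  shows "stable {h \<in> W. cd h \<in> M}"
proof -
  have m: "matching edges M" using M by (simp add: maximal_matching_def)
  have False if h: "h \<in> W" "cd h \<in> M" and k: "k \<in> W" "cd k \<in> M" and "R h k" for h k
  proof -
    have hk: "(h, k) \<in> cross" using that by (simp add: cross_def)
    then have n: "pq h k \<notin> M" by (rule cross)
    have disj: "pq h k \<inter> e = {}" if e: "e \<in> M" for e
    proof -
      have "e \<in> edges" using m e by (auto simp: matching_def)
      then consider g where "e = pc g" | g where "e = cd g" | g where "e = dq g"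
        | i j where "(i, j) \<in> cross" "e = pq i j"
        by (auto simp: edges_def)
      then show ?thesis
      proof cases
        case (1 g)
        have "g \<noteq> h" using matchingD[OF m h(2) e] 1 by (auto simp: edge_Int_simps edge_eq_simps)
        then show ?thesis using 1 by (simp add: edge_Int_simps)
      next
        case (2 g)
        then show ?thesis by (simp add: edge_Int_simps)
      next
        case (3 g)
        have "g \<noteq> k" using matchingD[OF m k(2) e] 3 by (auto simp: edge_Int_simps edge_eq_simps)
        then show ?thesis using 3 by (simp add: edge_Int_simps)
      next
        case (4 i j)
        then show ?thesis using cross e by blast
      qed
    qed
    have "pq h k \<in> edges" using hk by (auto simp: edges_def)
    then have "matching edges (insert (pq h k) M)"
      using m disj unfolding matching_def by (simp add: Int_commute)
    moreover have "M \<subset> insert (pq h k) M" using n by blast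
    ultimately show False using M unfolding maximal_matching_def by blast
  qed
  then show ?thesis unfolding stable_def by blast
qed

text \<open>A matching outside the intended face loses at least one unit in the integral penalty term,
  and its weight \<open>sum w W\<close> outweighs everything that can be gained.\<close>
lemma functional_maximal_matching_le:
  assumes M: "maximal_matching edges M" and w: "\<And>h. h \<in> W \<Longrightarrow> 0 \<le> w h" and r: "0 \<le> r"
    and bound: "\<And>S. stable S \<Longrightarrow> sum w S \<le> r"
  shows "functional w (incidence_vector M) \<le> r + sum w W * (2 * real (card W))"
proof -
  define x :: "nat set \<Rightarrow> real" where "x = indicator M"
  have m: "matching edges M" using M by (simp add: maximal_matching_def)
  have x01: "x e = (if e \<in> M then 1 else 0)" for e by (simp add: x_def indicator_def)
  define \<beta> where "\<beta> h = x (pc h) + 2 * x (cd h) + x (dq h)" for h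
  define \<gamma> where "\<gamma> = (\<Sum>(h, k)\<in>cross. x (pq h k))"
  have excl: "\<not> (cd h \<in> M \<and> (pc h \<in> M \<or> dq h \<in> M))" for h
    using matchingD[OF m, of "cd h" "pc h"] matchingD[OF m, of "cd h" "dq h"]
    by (auto simp: edge_Int_simps edge_eq_simps)
  have \<beta>2: "\<beta> h \<le> 2" for h using excl[of h] by (auto simp: \<beta>_def x01)
  have \<gamma>0: "\<gamma> \<ge> 0" unfolding \<gamma>_def by (intro sum_nonneg) (auto simp: x01)
  have K: "sum w W \<ge> 0" using w by (rule sum_nonneg)
  have val: "functional w (incidence_vector M)
      = sum w {h \<in> W. cd h \<in> M} + sum w W * (sum \<beta> W - \<gamma>)"
    unfolding functional_def incidence_vector_def sum_indicator_cd \<beta>_def \<gamma>_def x_def by simp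
  show ?thesis
  proof (cases "(\<forall>h\<in>W. cd h \<in> M \<or> pc h \<in> M \<and> dq h \<in> M) \<and> (\<forall>(h, k)\<in>cross. pq h k \<notin> M)")
    case True
    then have "stable {h \<in> W. cd h \<in> M}" by (intro stable_of_maximal_matching[OF M]) auto
    from bound[OF this] have "sum w {h \<in> W. cd h \<in> M} \<le> r" .
    moreover have "sum \<beta> W \<le> (\<Sum>h\<in>W. 2)" by (intro sum_mono \<beta>2)
    then have "sum w W * (sum \<beta> W - \<gamma>) \<le> sum w W * (2 * real (card W))"
      using \<gamma>0 K by (intro mult_left_mono) auto
    ultimately show ?thesis unfolding val by simp
  next
    case False
    \<comment> \<open>Off the face, either some \<open>\<beta> h\<close> is at most 1 or a cross
      edge makes \<open>\<gamma>\<close> at least 1.\<close>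
    have "sum \<beta> W - \<gamma> \<le> 2 * real (card W) - 1"
    proof (cases "\<forall>h\<in>W. cd h \<in> M \<or> pc h \<in> M \<and> dq h \<in> M")
      case True
      with False obtain h k where hk: "(h, k) \<in> cross" "pq h k \<in> M" by auto
      have "(\<lambda>(h, k). x (pq h k)) (h, k) \<le> \<gamma>"
        unfolding \<gamma>_def by (rule member_le_sum[OF hk(1)]) (use finite_cross in \<open>auto simp: x01 split: if_splits\<close>)
      then have "\<gamma> \<ge> 1" using hk by (simp add: x01)
      moreover have "sum \<beta> W \<le> (\<Sum>h\<in>W. 2)" by (intro sum_mono \<beta>2)
      ultimately show ?thesis by simp
    next
      case False
      then obtain h where h: "h \<in> W" "\<not> (cd h \<in> M \<or> pc h \<in> M \<and> dq h \<in> M)" by blast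
      then have "\<beta> h \<le> 1" by (auto simp: \<beta>_def x01)
      moreover have "sum \<beta> (W - {h}) \<le> (\<Sum>h\<in>W - {h}. 2)" by (intro sum_mono \<beta>2)
      moreover have "sum \<beta> W = \<beta> h + sum \<beta> (W - {h})" using finite_W h by (simp add: sum.remove)
      moreover have "(\<Sum>h\<in>W. 2 :: real) = 2 + (\<Sum>h\<in>W - {h}. 2)"
        by (rule sum.remove[OF finite_W h(1)])
      ultimately show ?thesis using \<gamma>0 by simp
    qed
    then have "sum w W * (sum \<beta> W - \<gamma>) \<le> sum w W * (2 * real (card W) - 1)"
      using K by (rule mult_left_mono)
    \<comment> \<open>The gain is at most the penalty \<open>sum w W\<close>, so
      \<open>0 \<le> r\<close> settles the case.\<close>
    moreover have "sum w {h \<in> W. cd h \<in> M} \<le> sum w W"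
      using finite_W w by (intro sum_mono2) auto
    ultimately show ?thesis unfolding val using r by (simp add: algebra_simps)
  qed
qed

end

section \<open>The twice subdivided complete graph\<close>

text \<open>\<open>(i, i)\<close> is the \<open>i\<close>-th branch vertex; the subdivided edge between \<open>i\<close> and \<open>j\<close> is the path
  \<open>(i, i), (i, j), (j, i), (j, j)\<close>.\<close>
definition subdivided_adj :: "nat \<times> nat \<Rightarrow> nat \<times> nat \<Rightarrow> bool" where
  "subdivided_adj = (\<lambda>(i, j) (k, l). i \<noteq> j \<and> (k = i \<and> l = i \<or> k = j \<and> l = i))"

text \<open>Let \<open>k = card a\<close> and let \<open>s\<close> be the number of chosen branch
  vertices in \<open>a\<close>, with 0/1 indicators \<open>z\<close>. In a stable set each edge
  inside \<open>a\<close> contributes at most \<open>2 * (1 - z i * z j)\<close>, so the total is at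
  most \<open>k^2 - k + 1 - (1 - s)^2\<close>.\<close>

definition subset_weight :: "nat set \<Rightarrow> nat \<times> nat \<Rightarrow> real" where
  "subset_weight a = (\<lambda>(i, j). if i \<in> a \<and> j \<in> a then if i = j then 1 else 2 else 0)"

text \<open>Every edge with an end outside \<open>b\<close> gets one subdivision vertex, adjacent to
  such an end; \<open>i < j\<close> breaks the tie if both ends are outside. So the edgewise bound
  is attained.\<close>

definition stable_of :: "nat \<Rightarrow> nat set \<Rightarrow> (nat \<times> nat) set" where
  "stable_of n b = {(i, j). i < n \<and> j < n \<and> (if i = j then i \<in> b else i \<notin> b \<and> (j \<in> b \<or> i < j))}"

definition ind :: "'a set \<Rightarrow> 'a \<Rightarrow> real" where
  "ind S x = (if x \<in> S then 1 else 0)"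

text \<open>Adding the double sum to its transpose joins the two subdivision vertices of each edge,
  whence the factor 2.\<close>

lemma sum_subset_weight:
  assumes a: "a \<subseteq> {..<n}" and S: "S \<subseteq> {..<n} \<times> {..<n}"
  shows "2 * sum (subset_weight a) S =
    (\<Sum>i\<in>a. \<Sum>j\<in>a. if i = j then 2 * ind S (i, i) else 2 * (ind S (i, j) + ind S (j, i)))"
proof -
  have fin: "finite a" "finite S" using a S by (auto intro: finite_subset)
  define T where "T i j = (if i = j then 1 else 2) * ind S (i, j)" for i j
  have "sum (subset_weight a) S = sum (subset_weight a) (S \<inter> a \<times> a)"
    using fin by (intro sum.mono_neutral_right) (auto simp: subset_weight_def split: if_splits)
  also have "\<dots> = (\<Sum>(i, j)\<in>a \<times> a. T i j)"
    using fin by (intro sum.mono_neutral_cong_left) (auto simp: subset_weight_def T_def ind_def split: if_splits)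
  also have "\<dots> = (\<Sum>i\<in>a. \<Sum>j\<in>a. T i j)" by (simp add: sum.cartesian_product)
  finally have s: "sum (subset_weight a) S = (\<Sum>i\<in>a. \<Sum>j\<in>a. T i j)" .
  also have "\<dots> = (\<Sum>i\<in>a. \<Sum>j\<in>a. T j i)" by (rule sum.swap)
  finally have "2 * sum (subset_weight a) S = (\<Sum>i\<in>a. \<Sum>j\<in>a. T i j + T j i)"
    using s by (simp add: sum.distrib)
  also have "\<dots> = (\<Sum>i\<in>a. \<Sum>j\<in>a. if i = j then 2 * ind S (i, i) else 2 * (ind S (i, j) + ind S (j, i)))"
    by (intro sum.cong) (auto simp: T_def)
  finally show ?thesis .
qed

text \<open>Extending the off-diagonal formula to the diagonal makes the double sum factor. The
  final sum of \<open>(z i)^2 - z i\<close> vanishes for 0/1 values.\<close>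

lemma sum_pairs_quadratic:
  assumes "finite a"
  shows "(\<Sum>i\<in>a. \<Sum>j\<in>a. if i = j then 2 * z i else 2 * (1 - z i * z j))
    = 2 * (real (card a)^2 - real (card a) + 2 * sum z a - (sum z a)^2 + (\<Sum>i\<in>a. (z i)^2 - z i))"
proof -
  have "(\<Sum>i\<in>a. \<Sum>j\<in>a. if i = j then 2 * z i else 2 * (1 - z i * z j)) =
     (\<Sum>i\<in>a. \<Sum>j\<in>a. 2 * (1 - z i * z j) + (if i = j then 2 * (z i - 1 + z i * z i) else 0))"
    by (intro sum.cong) auto
  also have "\<dots> = (\<Sum>i\<in>a. (\<Sum>j\<in>a. 2 * (1 - z i * z j)) + 2 * (z i - 1 + z i * z i))"
    using assms by (intro sum.cong) (simp_all add: sum.distrib)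
  also have "\<dots> = (\<Sum>i\<in>a. 2 * (real (card a) - z i * sum z a) + 2 * (z i - 1 + z i * z i))"
  proof (intro sum.cong refl arg_cong2[where f = "(+)"])
    fix i
    have "(\<Sum>j\<in>a. 2 * (1 - z i * z j)) = 2 * (\<Sum>j\<in>a. 1 - z i * z j)"
      by (simp only: sum_distrib_left)
    then show "(\<Sum>j\<in>a. 2 * (1 - z i * z j)) = 2 * (real (card a) - z i * sum z a)"
      by (simp add: sum_subtractf sum_distrib_left)
  qed
  also have "\<dots> = (\<Sum>i\<in>a. 2 * real (card a) - 2 + (4 - 2 * sum z a) * z i + 2 * ((z i)^2 - z i))"
    by (intro sum.cong refl) (simp add: power2_eq_square algebra_simps)
  also have "\<dots> = real (card a) * (2 * real (card a) - 2) + (4 - 2 * sum z a) * sum z a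
      + 2 * (\<Sum>i\<in>a. (z i)^2 - z i)"
    by (simp only: sum.distrib sum_constant sum_distrib_left[symmetric])
  also have "\<dots> = 2 * (real (card a)^2 - real (card a) + 2 * sum z a - (sum z a)^2 + (\<Sum>i\<in>a. (z i)^2 - z i))"
    by (simp only: power2_eq_square) (simp add: algebra_simps)
  finally show ?thesis .
qed

lemma sum_ind: "finite a \<Longrightarrow> sum (ind b) a = card (a \<inter> b)"
  by (simp add: ind_def sum.If_cases Collect_conj_eq[symmetric] Int_def)

lemma subset_weight_le:
  assumes a: "a \<subseteq> {..<n}" and S: "S \<subseteq> {..<n} \<times> {..<n}"
    and st: "\<And>h k. h \<in> S \<Longrightarrow> k \<in> S \<Longrightarrow> \<not> subdivided_adj h k"
  shows "sum (subset_weight a) S \<le> real (card a)^2 - real (card a) + 1"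
proof -
  have fin: "finite a" using a finite_subset by blast
  define z where "z i = ind S (i, i)" for i
  define s where "s = sum z a"
  have z: "(\<Sum>i\<in>a. (z i)^2 - z i) = 0" by (rule sum.neutral) (auto simp: z_def ind_def)
  have "2 * sum (subset_weight a) S \<le> (\<Sum>i\<in>a. \<Sum>j\<in>a. if i = j then 2 * z i else 2 * (1 - z i * z j))"
    unfolding sum_subset_weight[OF a S]
  proof (intro sum_mono)
    fix i j
    show "(if i = j then 2 * ind S (i, i) else 2 * (ind S (i, j) + ind S (j, i)))
      \<le> (if i = j then 2 * z i else 2 * (1 - z i * z j))"
      \<comment> \<open>These are the three edges of the path that subdivides the edge between
        \<open>i\<close> and \<open>j\<close>.\<close>
      using st[of "(i, j)" "(i, i)"] st[of "(i, j)" "(j, i)"] st[of "(j, i)" "(j, j)"]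
      by (auto simp: z_def ind_def subdivided_adj_def)
  qed
  also have "\<dots> = 2 * (real (card a)^2 - real (card a) + 2 * s - s^2)"
    unfolding sum_pairs_quadratic[OF fin] z s_def by simp
  also have "\<dots> \<le> 2 * (real (card a)^2 - real (card a) + 1)"
  proof -
    have "0 \<le> (s - 1)^2" by simp
    then show ?thesis by (simp add: power2_eq_square algebra_simps)
  qed
  finally show ?thesis by simp
qed

lemma subset_weight_stable_of:
  assumes a: "a \<subseteq> {..<n}" and b: "b \<subseteq> {..<n}"
  shows "sum (subset_weight a) (stable_of n b)
    = real (card a)^2 - real (card a) + 2 * real (card (a \<inter> b)) - real (card (a \<inter> b))^2"
proof -
  have fin: "finite a" using a finite_subset by blast
  have S: "stable_of n b \<subseteq> {..<n} \<times> {..<n}" by (auto simp: stable_of_def)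
  have z: "(\<Sum>i\<in>a. (ind b i)^2 - ind b i) = 0" by (rule sum.neutral) (auto simp: ind_def)
  have "2 * sum (subset_weight a) (stable_of n b)
      = (\<Sum>i\<in>a. \<Sum>j\<in>a. if i = j then 2 * ind b i else 2 * (1 - ind b i * ind b j))"
    unfolding sum_subset_weight[OF a S] using a
    by (intro sum.cong refl) (auto simp: stable_of_def ind_def)
  also have "\<dots> = 2 * (real (card a)^2 - real (card a) + 2 * card (a \<inter> b) - real (card (a \<inter> b))^2)"
    unfolding sum_pairs_quadratic[OF fin] z sum_ind[OF fin] by simp
  finally show ?thesis by simp
qed

lemma stable_of_stable:
  assumes "h \<in> stable_of n b" "k \<in> stable_of n b"
  shows "\<not> subdivided_adj h k"
  using assms by (auto simp: stable_of_def subdivided_adj_def split: if_splits)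

section \<open>The hard family of bipartite graphs\<close>

definition cell_grid :: "nat \<Rightarrow> (nat \<times> nat) set" where
  "cell_grid n = {..<n} \<times> {..<n}"

lemma path_replacement_grid: "path_replacement prod_encode (cell_grid n)"
  by standard (simp_all add: inj_prod_encode cell_grid_def)

abbreviation hard_vertices :: "nat \<Rightarrow> nat set" where
  "hard_vertices n \<equiv> path_replacement.vertices prod_encode (cell_grid n)"

abbreviation hard_edges :: "nat \<Rightarrow> nat set set" where
  "hard_edges n \<equiv> path_replacement.edges prod_encode (cell_grid n) subdivided_adj"

proposition ext_complexity_hard_graph:
  "3 ^ n \<le> (ext_complexity (maximal_matching_polytope (hard_edges n)) + 1) * 2 ^ n"
proof -
  interpret path_replacement prod_encode "cell_grid n" subdivided_adj
    by (rule path_replacement_grid)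
  define X where "X = {incidence_vector M | M. maximal_matching edges M}"
  have "X \<subseteq> incidence_vector ` Pow edges"
    by (auto simp: X_def maximal_matching_def matching_def)
  then have X: "finite X" using finite_edges by (auto intro: finite_subset)
  have st: "stable (stable_of n b)" for b
    unfolding stable_def using stable_of_stable by (auto simp: stable_of_def cell_grid_def)
  \<comment> \<open>The bound for stable sets, shifted by the value of the penalty term on the
    face.\<close>
  define r where "r a = real (card a)^2 - real (card a) + 1
    + sum (subset_weight a) (cell_grid n) * (2 * real (card (cell_grid n)))" for a
  have "3 ^ card {..<n} \<le> (ext_complexity (convex hull X) + 1) * 2 ^ card {..<n}"
  proof (rule ext_complexity_disjointness[OF X, where \<phi> = "\<lambda>a. functional (subset_weight a)"
        and r = r and y = "\<lambda>b. incidence_vector (matching_of (stable_of n b))"])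
    fix a x assume a: "a \<subseteq> {..<n}" and "x \<in> X"
    then obtain M where M: "maximal_matching edges M" and x: "x = incidence_vector M"
      by (auto simp: X_def)
    show "functional (subset_weight a) x \<le> r a"
      unfolding x r_def
    proof (rule functional_maximal_matching_le[OF M])
      show "0 \<le> real (card a)^2 - real (card a) + 1"
      proof (cases "card a")
        case (Suc m)
        then show ?thesis by (simp add: power2_eq_square algebra_simps)
      qed simp
      show "sum (subset_weight a) S \<le> real (card a)^2 - real (card a) + 1" if S: "stable S" for S
      proof (rule subset_weight_le[OF a])
        show "S \<subseteq> {..<n} \<times> {..<n}"
          using S unfolding stable_def by (simp add: cell_grid_def)
        show "\<not> subdivided_adj h k" if "h \<in> S" "k \<in> S" for h k
          using S that unfolding stable_def by blast
      qed
    qed (auto simp: subset_weight_def)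
  next
    fix b show "incidence_vector (matching_of (stable_of n b)) \<in> X"
      unfolding X_def using maximal_matching_of[OF st] by blast
  next
    fix a b assume ab: "a \<subseteq> {..<n}" "b \<subseteq> {..<n}"
    \<comment> \<open>The slack \<open>(1 - card (a \<inter> b))^2\<close> is 0 for one common
      element and 1 for disjoint sets.\<close>
    have val: "functional (subset_weight a) (incidence_vector (matching_of (stable_of n b)))
      = r a - 1 + 2 * real (card (a \<inter> b)) - real (card (a \<inter> b))^2"
      unfolding functional_matching_of[OF st] subset_weight_stable_of[OF ab] r_def by simp
    show "functional (subset_weight a) (incidence_vector (matching_of (stable_of n b))) = r a"
      if "card (a \<inter> b) = 1"
      unfolding val that by simp
    show "functional (subset_weight a) (incidence_vector (matching_of (stable_of n b))) < r a"
      if "a \<inter> b = {}"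
      unfolding val that by simp
  qed (simp_all add: linear_functional)
  then show ?thesis by (simp add: X_def maximal_matching_polytope_def)
qed

section \<open>Superpolynomial growth and conclusion\<close>

lemma polynomial_less_power:
  "\<exists>n. (real c * real n ^ d + real c + 1) < (3 / 2) ^ n"
proof -
  define l :: real where "l = ln (3 / 2)"
  define x :: real where "x = inverse (3 / 2)"
  have l: "l > 0" by (simp add: l_def)
  have ex: "exp (real n * l) = (3 / 2) ^ n" for n
    by (simp add: l_def exp_of_nat_mult)
  have "filterlim (\<lambda>n. real n * l) at_top sequentially"
    by (rule filterlim_at_top_mult_tendsto_pos[OF tendsto_const l filterlim_real_sequentially])
  \<comment> \<open>The limit of \<open>t ^ d / exp t\<close> is used at \<open>t = n * l\<close>;
    the factor \<open>inverse (l ^ d)\<close> undoes the scaling.\<close>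
  from filterlim_compose[OF tendsto_power_div_exp_0 this, of d]
  have "(\<lambda>n. inverse (l ^ d) * ((real n * l) ^ d / (3 / 2) ^ n)) \<longlonglongrightarrow> inverse (l ^ d) * 0"
    unfolding ex by (intro tendsto_mult tendsto_const)
  moreover have "inverse (l ^ d) * ((real n * l) ^ d / (3 / 2) ^ n) = real n ^ d * x ^ n" for n
  proof -
    have "inverse (l ^ d) * (real n ^ d * l ^ d * z) = real n ^ d * z" for z
      using l by simp
    then show ?thesis unfolding x_def power_mult_distrib power_inverse divide_inverse .
  qed
  ultimately have A: "(\<lambda>n. real n ^ d * x ^ n) \<longlonglongrightarrow> 0" by (simp only: mult_zero_right)
  have B: "(\<lambda>n. x ^ n) \<longlonglongrightarrow> 0" by (auto simp: x_def intro!: LIMSEQ_power_zero)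
  have "(\<lambda>n. real c * (real n ^ d * x ^ n) + (real c + 1) * x ^ n) \<longlonglongrightarrow> real c * 0 + (real c + 1) * 0"
    by (rule tendsto_add[OF tendsto_mult_left[OF A] tendsto_mult_left[OF B]])
  then have "eventually (\<lambda>n. real c * (real n ^ d * x ^ n) + (real c + 1) * x ^ n < 1) sequentially"
    by (rule order_tendstoD) simp
  then obtain n where "real c * (real n ^ d * x ^ n) + (real c + 1) * x ^ n < 1"
    by (auto simp: eventually_sequentially)
  then have "(real c * (real n ^ d * x ^ n) + (real c + 1) * x ^ n) * (3 / 2) ^ n < 1 * (3 / 2) ^ n"
    by (intro mult_strict_right_mono) auto
  moreover have "x ^ n * (3 / 2) ^ n = 1"
    unfolding power_mult_distrib[symmetric] by (simp add: x_def)
  ultimately show ?thesis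
    by (intro exI[of _ n]) (simp add: distrib_right mult.assoc)
qed

theorem theorem5:
  shows "\<exists>(V :: nat \<Rightarrow> nat set) (E :: nat \<Rightarrow> nat set set).
           (\<forall>n. bipartite (V n) (E n)) \<and>
           (\<exists>c d::nat. \<forall>n. card (V n) \<le> c * n ^ d + c) \<and>
           \<not> (\<exists>c d::nat. \<forall>n.
                 ext_complexity (maximal_matching_polytope (E n)) \<le> c * n ^ d + c)"
proof -
  have bip: "bipartite (hard_vertices n) (hard_edges n)" for n
    by (rule path_replacement.bipartite_edges[OF path_replacement_grid])
  \<comment> \<open>There are \<open>n ^ 2\<close> grid cells with four vertices each; the summand 4
    only fits the form \<open>c * n ^ d + c\<close>.\<close>
  have card: "card (hard_vertices n) \<le> 4 * n ^ 2 + 4" for n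
  proof -
    have "card (hard_vertices n) \<le> 4 * card (cell_grid n)"
      by (rule path_replacement.card_vertices[OF path_replacement_grid])
    then show ?thesis by (simp add: cell_grid_def power2_eq_square)
  qed
  have superpoly: False
    if poly: "\<And>n. ext_complexity (maximal_matching_polytope (hard_edges n)) \<le> c * n ^ d + c" for c d
  proof -
    obtain n where n: "real c * real n ^ d + real c + 1 < (3 / 2) ^ n"
      using polynomial_less_power by blast
    have "3 ^ n \<le> (ext_complexity (maximal_matching_polytope (hard_edges n)) + 1) * 2 ^ n"
      by (rule ext_complexity_hard_graph)
    also have "\<dots> \<le> (c * n ^ d + c + 1) * 2 ^ n"
      using poly[of n] by simp
    finally have "real (3 ^ n) \<le> real ((c * n ^ d + c + 1) * 2 ^ n)"
      by (rule of_nat_mono)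
    then have "(3 / 2) ^ n \<le> real c * real n ^ d + real c + 1"
      by (simp add: power_divide divide_le_eq algebra_simps)
    then show False using n by simp
  qed
  show ?thesis
  proof (rule exI[of _ hard_vertices], rule exI[of _ hard_edges], intro conjI)
    show "\<forall>n. bipartite (hard_vertices n) (hard_edges n)" using bip ..
    show "\<exists>c d. \<forall>n. card (hard_vertices n) \<le> c * n ^ d + c"
      by (rule exI[of _ 4], rule exI[of _ 2], rule allI, rule card)
    show "\<nexists>c d. \<forall>n. ext_complexity (maximal_matching_polytope (hard_edges n)) \<le> c * n ^ d + c"
    proof
      assume "\<exists>c d. \<forall>n. ext_complexity (maximal_matching_polytope (hard_edges n)) \<le> c * n ^ d + c"
      then obtain c d where
        "\<forall>n. ext_complexity (maximal_matching_polytope (hard_edges n)) \<le> c * n ^ d + c"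
        by (elim exE)
      then show False by (intro superpoly[of c d]) (rule spec)
    qed
  qed
qed

end
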